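(* Let $\Lambda\subset\mathbb Z^r$ be a finitely generated submonoid that is primitive in its group completion $\underline\Lambda$. Let $A$ be an associative $\mathbb C$-algebra which is finitely generated as a module over its center $Z$ and which, as a $\mathbb C$-vector space, has basis $S=\{s_{\mathbf m}\mid\mathbf m\in\Lambda\}$. Assume there exists a monoid homomorphism $\deg:\Lambda\to\mathbb N^p$ such that for all $\mathbf m,\mathbf m'\in\Lambda$ $$s_{\mathbf m}\cdot s_{\mathbf m'}=q^{C(\mathbf m,\mathbf m')}s_{\mathbf m+\mathbf m'}\pmod{F_{<\deg(\mathbf m)+\deg(\mathbf m')}},$$ where $q\in\mathbb C^\times$ is a root of unity, $C(\mathbf m,\mathbf m')\in\mathbb Z$, and for $\mathbf n\in\mathbb N^p$, $F_{<\mathbf n}$ is the $\mathbb C$-span of $\{s_{\mathbf m}\in S\mid\deg(\mathbf m)<\mathbf n\}$. Here $\mathbb N^p$ is equipped with the lexicographic order. Then $A$ is a domain and a maximal order.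
   Context: $\underline\Lambda=\{\mathbf k-\mathbf k'\mid\mathbf k,\mathbf k'\in\Lambda\}$ is the group generated by $\Lambda$. $\Lambda$ is primitive in $\underline\Lambda$ if whenever $c\mathbf k\in\Lambda$ for some positive integer $c$ and $\mathbf k\in\underline\Lambda$, then $\mathbf k\in\Lambda$. $p$ is a fixed positive integer and $\mathbb N$ contains $0$. Maximal order: let $A$ be an algebra that is a domain and is finitely generated as a module over its center $Z$; let $\widetilde Z$ be the field of fractions of $Z$. $A$ is a maximal order if any subring $B$ of $A\otimes_Z\widetilde Z$ with $A\subset B\subset(z^{-1})A$ for some nonzero $z\in Z$ satisfies $B=A$, where $(z^{-1})A=\{z^{-1}a\mid a\in A\}$ (a set, not a localization). *)

theory Defs
  imports
    Complex_Main
    "HOL-Library.Function_Algebras"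
    "HOL-Library.Fun_Lexorder"
    "HOL-Algebra.Subrings"
    "HOL-Algebra.Free_Abelian_Groups"
begin

text \<open>
  An \<open>n\<close>-tuple is a sequence that vanishes from index \<open>n\<close> on, with pointwise addition.  On such
  sequences of naturals, \<^const>\<open>less_fun\<close> is the strict lexicographic order.
\<close>

definition tuples :: "nat \<Rightarrow> (nat \<Rightarrow> 'b::zero) set" where
  "tuples n = {v. \<forall>i\<ge>n. v i = 0}"

definition add_submonoid :: "'b::monoid_add set \<Rightarrow> bool" where
  "add_submonoid M \<longleftrightarrow> 0 \<in> M \<and> (\<forall>x\<in>M. \<forall>y\<in>M. x + y \<in> M)"

definition fin_gen_submonoid :: "'b::monoid_add set \<Rightarrow> bool" where
  "fin_gen_submonoid M \<longleftrightarrow> (\<exists>G. finite G \<and> M = add_submonoid hull G)"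

definition group_completion :: "'b::ab_group_add set \<Rightarrow> 'b set" where
  "group_completion M = {k - k' | k k'. k \<in> M \<and> k' \<in> M}"

definition primitive_in_completion :: "(nat \<Rightarrow> int) set \<Rightarrow> bool" where
  "primitive_in_completion M \<longleftrightarrow>
     (\<forall>c::nat. \<forall>k\<in>group_completion M. c > 0 \<longrightarrow> (\<lambda>i. int c * k i) \<in> M \<longrightarrow> k \<in> M)"


locale complex_algebra = vector_space scale
  for scale :: "complex \<Rightarrow> 'a::ring_1 \<Rightarrow> 'a" +
  assumes scale_mult_left: "scale c x * y = scale c (x * y)"
    and scale_mult_right: "x * scale c y = scale c (x * y)"

definition filtration_less ::
    "(complex \<Rightarrow> 'a::ring_1 \<Rightarrow> 'a) \<Rightarrow> 'm set \<Rightarrow> ('m \<Rightarrow> 'a) \<Rightarrow> ('m \<Rightarrow> nat \<Rightarrow> nat) \<Rightarrow> (nat \<Rightarrow> nat) \<Rightarrow> 'a set"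
  where "filtration_less scale \<Lambda> s d n = module.span scale (s ` {m \<in> \<Lambda>. less_fun (d m) n})"


definition center :: "'a::ring_1 set" where
  "center = {z. \<forall>x. z * x = x * z}"

definition fin_gen_over_center :: "'a::ring_1 itself \<Rightarrow> bool" where
  "fin_gen_over_center _ \<longleftrightarrow>
     (\<exists>G::'a set. finite G \<and> (\<forall>a. \<exists>c. (\<forall>g\<in>G. c g \<in> center) \<and> a = (\<Sum>g\<in>G. c g * g)))"

definition is_domain :: "'a::ring_1 itself \<Rightarrow> bool" where
  "is_domain _ \<longleftrightarrow> (1::'a) \<noteq> 0 \<and> (\<forall>x y::'a. x * y = 0 \<longrightarrow> x = 0 \<or> y = 0)"


text \<open>
  The field of fractions of the center \<open>Z\<close> of a domain: equivalence classes of pairs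
  (numerator, denominator).  The operations on classes are the unions over all representatives.
\<close>

definition center_fract :: "'a::ring_1 \<Rightarrow> 'a \<Rightarrow> ('a \<times> 'a) set" where
  "center_fract a z = {(b, w). b \<in> center \<and> w \<in> center - {0} \<and> a * w = b * z}"

definition center_fraction_field :: "('a::ring_1 \<times> 'a) set ring" where
  "center_fraction_field =
     \<lparr>carrier = {center_fract a z | a z. a \<in> center \<and> z \<in> center - {0}},
      monoid.mult = (\<lambda>X Y. \<Union>(a, z)\<in>X. \<Union>(b, w)\<in>Y. center_fract (a * b) (z * w)),
      one = center_fract 1 1,
      ring.zero = center_fract 0 1,
      ring.add = (\<lambda>X Y. \<Union>(a, z)\<in>X. \<Union>(b, w)\<in>Y. center_fract (a * w + b * z) (z * w))\<rparr>"


text \<open>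
  The tensor product \<open>A \<otimes>\<^sub>Z Frac Z\<close>: the free abelian group on the pairs \<open>(a, x)\<close>, modulo the subgroup
  generated by the biadditivity and \<open>Z\<close>-balancing relations; its multiplication is induced by
  \<open>(a \<otimes> x) (b \<otimes> y) = a b \<otimes> x y\<close>, extended biadditively.
\<close>

type_synonym 'a formal_tensor = "('a \<times> ('a \<times> 'a) set) \<Rightarrow>\<^sub>0 int"

definition formal_tensors :: "'a::ring_1 formal_tensor monoid" where
  "formal_tensors = free_Abelian_group (UNIV \<times> carrier center_fraction_field)"

definition tensor_relations :: "'a::ring_1 formal_tensor set" where
  "tensor_relations =
     {frag_of (a + b, x) - frag_of (a, x) - frag_of (b, x) | a b x.
        x \<in> carrier center_fraction_field} \<union>
     {frag_of (a, x \<oplus>\<^bsub>center_fraction_field\<^esub> y) - frag_of (a, x) - frag_of (a, y) | a x y.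
        x \<in> carrier center_fraction_field \<and> y \<in> carrier center_fraction_field} \<union>
     {frag_of (a * z, x) - frag_of (a, center_fract z 1 \<otimes>\<^bsub>center_fraction_field\<^esub> x) | a z x.
        z \<in> center \<and> x \<in> carrier center_fraction_field}"

definition tensor_kernel :: "'a::ring_1 formal_tensor set" where
  "tensor_kernel = generate formal_tensors tensor_relations"

definition tensor_class :: "'a::ring_1 formal_tensor \<Rightarrow> 'a formal_tensor set" where
  "tensor_class t = tensor_kernel #>\<^bsub>formal_tensors\<^esub> t"

definition formal_mult ::
    "'a::ring_1 formal_tensor \<Rightarrow> 'a formal_tensor \<Rightarrow> 'a formal_tensor" where
  "formal_mult t u =
     frag_extend (\<lambda>(a, x). frag_extend
       (\<lambda>(b, y). frag_of (a * b, x \<otimes>\<^bsub>center_fraction_field\<^esub> y)) u) t"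

definition pure_tensor :: "'a::ring_1 \<Rightarrow> ('a \<times> 'a) set \<Rightarrow> 'a formal_tensor set" where
  "pure_tensor a x = tensor_class (frag_of (a, x))"

definition central_quotient_ring :: "'a::ring_1 formal_tensor set ring" where
  "central_quotient_ring =
     \<lparr>carrier = carrier (formal_tensors Mod tensor_kernel),
      monoid.mult = (\<lambda>X Y. \<Union>t\<in>X. \<Union>u\<in>Y. tensor_class (formal_mult t u)),
      one = pure_tensor 1 (center_fract 1 1),
      ring.zero = \<one>\<^bsub>formal_tensors Mod tensor_kernel\<^esub>,
      ring.add = monoid.mult (formal_tensors Mod tensor_kernel)\<rparr>"

definition quotient_embed :: "'a::ring_1 \<Rightarrow> 'a formal_tensor set" where
  "quotient_embed a = pure_tensor a (center_fract 1 1)"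

text \<open>The set of all \<open>z\<^sup>-\<^sup>1 a\<close> for the given \<open>z\<close>; it need not be a ring.\<close>

definition inverse_multiples :: "'a::ring_1 \<Rightarrow> 'a formal_tensor set set" where
  "inverse_multiples z =
     {pure_tensor 1 (center_fract 1 z) \<otimes>\<^bsub>central_quotient_ring\<^esub> quotient_embed a | a. True}"

definition maximal_order :: "'a::ring_1 itself \<Rightarrow> bool" where
  "maximal_order _ \<longleftrightarrow>
     is_domain TYPE('a) \<and> fin_gen_over_center TYPE('a) \<and>
     (\<forall>B. subring B (central_quotient_ring :: 'a formal_tensor set ring) \<longrightarrow>
          range quotient_embed \<subseteq> B \<longrightarrow>
          (\<exists>z\<in>center - {0::'a}. B \<subseteq> inverse_multiples z) \<longrightarrow>
          B = range quotient_embed)"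

end

theory Submission
  imports Defs
begin

text \<open>
  Order the exponents by degree, then by the value of an additive map \<open>l\<close>, then lexicographically.  Since the
  top part of \<open>s m * s m'\<close> is a nonzero multiple of \<open>s (m + m')\<close>, leading exponents add up under multiplication
  (\<open>lead_mult\<close>), whatever \<open>l\<close> is.  In particular \<open>A\<close> has no zero divisors.

  Let \<open>B\<close> be a ring with \<open>A \<subseteq> B \<subseteq> z^-1 A\<close> and let \<open>b = a / z\<close> be in \<open>B\<close>.  All powers of \<open>b\<close> lie in \<open>B\<close>, so \<open>z b^n\<close> is in \<open>A\<close>
  for all \<open>n\<close>.  Taking leading exponents \<open>v\<close>, all \<open>v z + n (v a - v z)\<close> lie in \<open>\<Lambda>\<close>.  A finitely generated primitive
  monoid is completely integrally closed (\<open>primitive_add_multiples\<close>, by Dickson's lemma), whence \<open>m = v a - v z\<close>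
  is in \<open>\<Lambda>\<close>, and subtracting a multiple of \<open>s m\<close> from \<open>b\<close> lowers its exponent.

  The difficulty is that this long division need not stop: degrees are well-ordered, but \<open>\<Lambda>\<close> may have infinitely
  many elements of one degree, and for general \<open>a\<close> and \<open>z\<close> the quotient would be an infinite series.  Again
  the powers of \<open>b\<close> help.  Comparing the exponents of \<open>z b^n\<close> for \<open>l = 0\<close> with those for an arbitrary \<open>l\<close> and letting
  \<open>n\<close> grow shows that \<open>l m\<close> is at most the difference of the maxima of \<open>l\<close> on the top degree parts of \<open>a\<close> and \<open>z\<close>
  (\<open>quotient_exponent_bound\<close>).  So division by \<open>z\<close> does not enlarge the Newton polytope of the top degree part.  With
  the coordinates and their negatives for \<open>l\<close>, the exponents that can occur in one degree are confined to a finite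
  box (\<open>division_terminates\<close>), and \<open>b\<close> ends up in \<open>A\<close>.

  The remaining work is to compute in \<open>A \<otimes>\<^sub>Z Frac Z\<close>: products and sums of pure tensors, and the injectivity
  of \<open>a \<mapsto> a \<otimes> 1/w\<close> (\<open>pure_tensor_inject\<close>), which translates statements on \<open>B\<close> into equations in \<open>A\<close> (\<open>maximal_orderI\<close>).
\<close>

section \<open>Finitely generated primitive monoids\<close>

text \<open>
  A monotone subsequence exists in any case; if it decreases, it is constant from its minimum onwards.
\<close>

lemma nat_sequence_mono_subseq:
  fixes f :: "nat \<Rightarrow> nat"
  obtains \<phi> :: "nat \<Rightarrow> nat" where "strict_mono \<phi>" "mono (\<lambda>n. f (\<phi> n))"
proof -
  obtain \<phi> where \<phi>: "strict_mono \<phi>" "monoseq (\<lambda>n. f (\<phi> n))"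
    using seq_monosub by blast
  show ?thesis
  proof (cases "mono (\<lambda>n. f (\<phi> n))")
    case True
    with \<phi>(1) show ?thesis by (rule that)
  next
    case False
    then have dec: "f (\<phi> n) \<le> f (\<phi> m)" if "m \<le> n" for m n
      using \<phi>(2) that unfolding monoseq_def mono_def by blast
    obtain N where N: "\<And>n. f (\<phi> N) \<le> f (\<phi> n)"
      using ex_has_least_nat[of "\<lambda>_. True" _ "\<lambda>n. f (\<phi> n)"] by blast
    have "f (\<phi> (N + n)) = f (\<phi> N)" for n
      using N dec[of N "N + n"] by (simp add: antisym)
    then show ?thesis
      using \<phi>(1) by (intro that[of "\<lambda>n. \<phi> (N + n)"]) (auto simp: strict_mono_def mono_def)
  qed
qed

text \<open>
  Dickson's lemma: coordinate by coordinate, pass to a subsequence on which that coordinate is monotone.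
\<close>

lemma dickson_subseq:
  fixes f :: "'g \<Rightarrow> nat \<Rightarrow> nat"
  assumes "finite G"
  shows "\<exists>\<phi> :: nat \<Rightarrow> nat. strict_mono \<phi> \<and> (\<forall>g\<in>G. mono (\<lambda>n. f g (\<phi> n)))"
  using assms
proof (induction G rule: finite_induct)
  case empty
  then show ?case by (auto intro: exI[of _ id] simp: strict_mono_def)
next
  case (insert g G)
  then obtain \<phi> :: "nat \<Rightarrow> nat" where \<phi>: "strict_mono \<phi>" "\<forall>g\<in>G. mono (\<lambda>n. f g (\<phi> n))" by blast
  obtain \<psi> :: "nat \<Rightarrow> nat" where \<psi>: "strict_mono \<psi>" "mono (\<lambda>n. f g (\<phi> (\<psi> n)))"
    by (rule nat_sequence_mono_subseq[of "\<lambda>n. f g (\<phi> n)"])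
  have "strict_mono (\<phi> \<circ> \<psi>)" using \<phi>(1) \<psi>(1) by (rule strict_mono_o)
  moreover have "mono (\<lambda>n. f h ((\<phi> \<circ> \<psi>) n))" if "h \<in> insert g G" for h
  proof (cases "h = g")
    case True
    with \<psi> show ?thesis by simp
  next
    case False
    then show ?thesis
      using \<phi>(2) that monoD[OF strict_mono_mono[OF \<psi>(1)]] by (simp add: mono_def)
  qed
  ultimately show ?case by blast
qed

lemma sum_constant_fun:
  fixes k :: "nat \<Rightarrow> int"
  shows "(\<Sum>i<n. k) = (\<lambda>j. int n * k j)"
  by (induction n) (auto simp: fun_eq_iff algebra_simps)

lemma add_submonoid_sum:
  assumes "add_submonoid M" "\<And>i. i \<in> I \<Longrightarrow> f i \<in> M"
  shows "sum f I \<in> (M :: 'b::comm_monoid_add set)"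
  using assms by (induction I rule: infinite_finite_induct) (auto simp: add_submonoid_def)

text \<open>
  A finitely generated primitive monoid is completely integrally closed.  Write each \<open>d + n m\<close> as a natural
  combination of the generators.  By Dickson's lemma some combination dominates an earlier one in every
  coefficient; their difference expresses a positive multiple of \<open>m\<close> as an element of \<open>\<Lambda>\<close>, and primitivity
  divides it.
\<close>

lemma primitive_add_multiples:
  fixes \<Lambda> :: "(nat \<Rightarrow> int) set"
  assumes sub: "add_submonoid \<Lambda>" and fg: "fin_gen_submonoid \<Lambda>"
    and prim: "primitive_in_completion \<Lambda>"
    and m: "m \<in> group_completion \<Lambda>" and multiples: "\<And>n::nat. d + (\<Sum>i<n. m) \<in> \<Lambda>"
  shows "m \<in> \<Lambda>"
proof -
  obtain G where G: "finite G" "\<Lambda> = add_submonoid hull G"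
    using fg unfolding fin_gen_submonoid_def by blast
  have G_sub: "G \<subseteq> \<Lambda>" using G(2) hull_subset by metis
  define comb where "comb c = (\<Sum>g\<in>G. \<Sum>i<(c g :: nat). g)" for c
  have "add_submonoid (range comb)"
    unfolding add_submonoid_def
  proof (intro conjI ballI)
    have "0 = comb (\<lambda>_. 0)" by (simp add: comb_def)
    then show "0 \<in> range comb" by (rule range_eqI[of _ comb])
  next
    fix x y assume "x \<in> range comb" "y \<in> range comb"
    then obtain c c' where "x = comb c" "y = comb c'" by blast
    then have "x + y = comb (\<lambda>g. c g + c' g)"
      by (simp only: comb_def sum_constant_fun flip: sum.distrib)
         (simp add: plus_fun_def algebra_simps)
    then show "x + y \<in> range comb" by (rule range_eqI[of _ comb])
  qed
  moreover have "G \<subseteq> range comb"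
  proof
    fix g assume "g \<in> G"
    then have "(\<Sum>h\<in>G. if h = g then g else 0) = g" using G(1) by simp
    moreover have "(\<Sum>h\<in>G. if h = g then g else 0) = comb (\<lambda>h. if h = g then 1 else 0)"
      unfolding comb_def by (intro sum.cong) auto
    ultimately have "g = comb (\<lambda>h. if h = g then 1 else 0)" by simp
    then show "g \<in> range comb" by (rule range_eqI[of _ comb])
  qed
  ultimately have "\<Lambda> \<subseteq> range comb"
    unfolding G(2) by (intro hull_minimal)
  then have "d + (\<Sum>i<n. m) \<in> range comb" for n :: nat using multiples[of n] by (rule subsetD)
  then have "\<forall>n::nat. \<exists>c. d + (\<Sum>i<n. m) = comb c" by (simp add: image_iff)
  from choice[OF this] obtain c where c: "\<And>n::nat. d + (\<Sum>i<n. m) = comb (c n)"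
    by (elim exE) simp
  obtain \<phi> :: "nat \<Rightarrow> nat" where \<phi>: "strict_mono \<phi>" "\<forall>g\<in>G. mono (\<lambda>n. c (\<phi> n) g)"
    using dickson_subseq[OF G(1), of "\<lambda>g n. c n g"] by blast
  define a b where "a = \<phi> 0" and "b = \<phi> 1"
  have ab: "a < b" using \<phi>(1) by (simp add: a_def b_def strict_mono_def)
  have le: "c a g \<le> c b g" if "g \<in> G" for g
    using \<phi>(2) that by (auto simp: mono_def a_def b_def)
  have "(\<Sum>i<b - a. m) = (d + (\<Sum>i<b. m)) - (d + (\<Sum>i<a. m))"
    using ab by (simp only: sum_constant_fun) (simp add: fun_eq_iff of_nat_diff algebra_simps)
  also have "\<dots> = comb (\<lambda>g. c b g - c a g)"
    unfolding c comb_def sum_subtractf[symmetric]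
    using le by (intro sum.cong) (auto simp only: sum_constant_fun
      , auto simp: fun_eq_iff of_nat_diff algebra_simps)
  also have "\<dots> \<in> \<Lambda>"
    unfolding comb_def using G_sub by (intro add_submonoid_sum[OF sub]) auto
  finally have "(\<lambda>j. int (b - a) * m j) \<in> \<Lambda>"
    by (simp only: sum_constant_fun)
  then show ?thesis
    using prim m ab unfolding primitive_in_completion_def by (metis zero_less_diff)
qed

section \<open>Leading exponents\<close>

text \<open>
  The order \<open>\<lless>\<close> need not be a well-order: when \<open>\<Lambda>\<close> contains a nontrivial group no total order compatible
  with addition is.  It is therefore only used to compare the finitely many exponents of given elements.
\<close>

locale leading_exponents = complex_algebra scale
  for scale :: "complex \<Rightarrow> 'a::ring_1 \<Rightarrow> 'a" +
  fixes \<Lambda> :: "'m::ab_group_add set" and s :: "'m \<Rightarrow> 'a"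
    and prec :: "'m \<Rightarrow> 'm \<Rightarrow> bool" (infix "\<lless>" 50)
  assumes exponents_add: "m \<in> \<Lambda> \<Longrightarrow> n \<in> \<Lambda> \<Longrightarrow> m + n \<in> \<Lambda>"
    and inj_s: "inj_on s \<Lambda>"
    and independent_s: "\<not> dependent (s ` \<Lambda>)"
    and span_s: "span (s ` \<Lambda>) = UNIV"
    and prec_irrefl: "\<not> m \<lless> m"
    and prec_trans: "k \<lless> m \<Longrightarrow> m \<lless> n \<Longrightarrow> k \<lless> n"
    and prec_total: "m \<in> \<Lambda> \<Longrightarrow> n \<in> \<Lambda> \<Longrightarrow> m \<lless> n \<or> m = n \<or> n \<lless> m"
    and prec_add: "k \<in> \<Lambda> \<Longrightarrow> m \<in> \<Lambda> \<Longrightarrow> n \<in> \<Lambda> \<Longrightarrow> m \<lless> n \<Longrightarrow> m + k \<lless> n + k"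
    and basis_mult: "m \<in> \<Lambda> \<Longrightarrow> n \<in> \<Lambda> \<Longrightarrow>
       \<exists>c. c \<noteq> 0 \<and> s m * s n - scale c (s (m + n)) \<in> span (s ` {k\<in>\<Lambda>. k \<lless> m + n})"
begin

definition lower :: "'m \<Rightarrow> 'a set" where
  "lower m = span (s ` {k\<in>\<Lambda>. k \<lless> m})"

definition lead :: "'a \<Rightarrow> 'm \<Rightarrow> bool" where
  "lead x m \<longleftrightarrow> m \<in> \<Lambda> \<and> (\<exists>c. c \<noteq> 0 \<and> x - scale c (s m) \<in> lower m)"

lemma lead_mem: "lead x m \<Longrightarrow> m \<in> \<Lambda>"
  unfolding lead_def by blast

lemma basis_product_lower:
  assumes "k \<in> \<Lambda>" "k' \<in> \<Lambda>" "k + k' \<lless> n"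
  shows "s k * s k' \<in> lower n"
proof -
  obtain c where c: "s k * s k' - scale c (s (k + k')) \<in> span (s ` {j\<in>\<Lambda>. j \<lless> k + k'})"
    using basis_mult assms by blast
  have "span (s ` {j\<in>\<Lambda>. j \<lless> k + k'}) \<subseteq> lower n"
    unfolding lower_def using assms(3) by (intro span_mono image_mono) (auto intro: prec_trans)
  moreover have "scale c (s (k + k')) \<in> lower n"
    unfolding lower_def using assms exponents_add by (intro span_scale span_base) auto
  ultimately have "(s k * s k' - scale c (s (k + k'))) + scale c (s (k + k')) \<in> lower n"
    using c unfolding lower_def by (blast intro: span_add)
  then show ?thesis by simp
qed

lemma span_product_lower:
  assumes "X \<subseteq> \<Lambda>" "Y \<subseteq> \<Lambda>" "\<And>k k'. k \<in> X \<Longrightarrow> k' \<in> Y \<Longrightarrow> k + k' \<lless> n"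
    and x: "x \<in> span (s ` X)" and y: "y \<in> span (s ` Y)"
  shows "x * y \<in> lower n"
  using x
proof (induction rule: span_induct_alt)
  case base
  then show ?case by (simp add: lower_def span_zero)
next
  case (step c u x')
  then obtain k where k: "k \<in> X" "u = s k" by auto
  have "s k * y \<in> lower n"
    using y
  proof (induction rule: span_induct_alt)
    case base
    then show ?case by (simp add: lower_def span_zero)
  next
    case (step d v y')
    then obtain k' where k': "k' \<in> Y" "v = s k'" by auto
    have "s k * s k' \<in> lower n"
      using assms(1-3) k k' by (intro basis_product_lower) auto
    with step.IH show ?case
      unfolding k'(2) distrib_left scale_mult_right lower_def by (intro span_add span_scale)
  qed
  with step.IH show ?case
    unfolding k(2) distrib_right scale_mult_left lower_def by (intro span_add span_scale)
qed

lemma lead_in_span: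
  assumes "lead x m"
  shows "x \<in> span (s ` {k\<in>\<Lambda>. k = m \<or> k \<lless> m})"
proof -
  obtain c where m: "m \<in> \<Lambda>" and c: "x - scale c (s m) \<in> lower m"
    using assms unfolding lead_def by blast
  have "lower m \<subseteq> span (s ` {k\<in>\<Lambda>. k = m \<or> k \<lless> m})"
    unfolding lower_def by (intro span_mono) auto
  moreover have "scale c (s m) \<in> span (s ` {k\<in>\<Lambda>. k = m \<or> k \<lless> m})"
    using m by (intro span_scale span_base) auto
  ultimately have "(x - scale c (s m)) + scale c (s m) \<in> span (s ` {k\<in>\<Lambda>. k = m \<or> k \<lless> m})"
    using c by (blast intro: span_add)
  then show ?thesis by simp
qed

text \<open>
  The leading monomials multiply to a nonzero multiple of the monomial at \<open>m + n\<close>, and every other product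
  of monomials that occurs has a strictly smaller exponent, so nothing can cancel it.
\<close>

lemma lead_mult:
  assumes x: "lead x m" and y: "lead y n"
  shows "lead (x * y) (m + n)"
proof -
  obtain a where m: "m \<in> \<Lambda>" and a: "a \<noteq> 0" "x - scale a (s m) \<in> lower m"
    using x unfolding lead_def by blast
  obtain b where n: "n \<in> \<Lambda>" and b: "b \<noteq> 0" "y - scale b (s n) \<in> lower n"
    using y unfolding lead_def by blast
  obtain c where c: "c \<noteq> 0" "s m * s n - scale c (s (m + n)) \<in> lower (m + n)"
    using basis_mult[OF m n] unfolding lower_def by blast
  have mono_l: "k + k' \<lless> m + n" if "k \<in> \<Lambda>" "k' \<in> \<Lambda>" "k \<lless> m" "k' = n \<or> k' \<lless> n" for k k'
  proof -
    have "k + k' \<lless> m + k'" using that m by (intro prec_add) auto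
    moreover have "m + k' = m + n \<or> m + k' \<lless> m + n"
      using that prec_add[of m k' n] m n by (auto simp: add.commute)
    ultimately show ?thesis by (auto intro: prec_trans)
  qed
  have 1: "(x - scale a (s m)) * y \<in> lower (m + n)"
    using a(2) lead_in_span[OF y] mono_l
    by (intro span_product_lower[of "{k\<in>\<Lambda>. k \<lless> m}" "{k\<in>\<Lambda>. k = n \<or> k \<lless> n}"])
       (auto simp: lower_def)
  have 2: "scale a (s m) * (y - scale b (s n)) \<in> lower (m + n)"
    using b(2) m n prec_add[of m _ n]
    by (intro span_product_lower[of "{m}" "{k\<in>\<Lambda>. k \<lless> n}"])
       (auto simp: lower_def add.commute span_scale span_base)
  have 3: "scale (a * b) (s m * s n - scale c (s (m + n))) \<in> lower (m + n)"
    using c(2) unfolding lower_def by (intro span_scale)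
  have "x * y - scale (a * b * c) (s (m + n)) = (x - scale a (s m)) * y
      + scale a (s m) * (y - scale b (s n)) + scale (a * b) (s m * s n - scale c (s (m + n)))"
    by (simp add: algebra_simps scale_mult_left scale_mult_right scale_right_diff_distrib
        scale_left_diff_distrib)
  also have "\<dots> \<in> lower (m + n)"
    using 1 2 3 unfolding lower_def by (intro span_add)
  finally show ?thesis
    unfolding lead_def using a b c exponents_add m n
    by (intro conjI exI[of _ "a * b * c"]) auto
qed

text \<open>
  Linear independence of the monomials makes \<open>lead\<close> independent of the way in which an element is
  written: a leading exponent of \<open>x\<close> occurs among any monomials whose span contains \<open>x\<close>.  Uniqueness of leading exponents, and
  the comparison of leading exponents for two different orders, follow.
\<close>

lemma lead_in_support:
  assumes "lead x m" "S \<subseteq> \<Lambda>" "x \<in> span (s ` S)"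
  shows "m \<in> S"
proof (rule ccontr)
  assume "m \<notin> S"
  obtain c where m: "m \<in> \<Lambda>" and c: "c \<noteq> 0" "x - scale c (s m) \<in> lower m"
    using assms unfolding lead_def by blast
  let ?V = "span (s ` (\<Lambda> - {m}))"
  have "lower m \<subseteq> ?V" "span (s ` S) \<subseteq> ?V"
    unfolding lower_def using \<open>m \<notin> S\<close> assms(2) prec_irrefl
    by (auto intro!: span_mono image_mono simp del: image_insert)
  then have "x - (x - scale c (s m)) \<in> ?V"
    using c assms(3) by (blast intro: span_diff)
  then have "scale c (s m) \<in> ?V" by simp
  then have "scale (1 / c) (scale c (s m)) \<in> ?V" by (rule span_scale)
  then have "s m \<in> span (s ` \<Lambda> - {s m})"
    using c(1) inj_s m by (simp add: inj_on_image_set_diff[of s \<Lambda>])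
  then show False using independent_s m unfolding dependent_def by blast
qed

lemma lead_nonzero: "lead x m \<Longrightarrow> x \<noteq> 0"
  using lead_in_support[of x m "{}"] by (auto simp: span_zero)

lemma lead_maximal:
  assumes "lead x m" "lead x n"
  shows "m = n \<or> m \<lless> n"
  using lead_in_support[OF assms(1) _ lead_in_span[OF assms(2)]] by auto

lemma lead_unique:
  assumes "lead x m" "lead x n"
  shows "m = n"
  using lead_maximal[OF assms] lead_maximal[OF assms(2,1)] prec_trans prec_irrefl by blast

lemma finite_has_prec_max:
  assumes "finite K" "K \<noteq> {}" "K \<subseteq> \<Lambda>"
  shows "\<exists>m\<in>K. \<forall>k\<in>K. k = m \<or> k \<lless> m"
  using assms
proof (induction rule: finite_ne_induct)
  case (singleton x)
  then show ?case by auto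
next
  case (insert x F)
  then obtain m where m: "m \<in> F" "\<forall>k\<in>F. k = m \<or> k \<lless> m" by auto
  consider "x \<lless> m" | "x = m" | "m \<lless> x" using prec_total m insert.prems by blast
  then show ?case
    using m prec_trans by cases (metis insert_iff)+
qed

lemma lead_exists:
  assumes "x \<noteq> 0"
  obtains m where "lead x m"
proof -
  have "\<exists>m. lead x m" if "finite K" "K \<subseteq> \<Lambda>" "x \<in> span (s ` K)" for K
    using that
  proof (induction "card K" arbitrary: K)
    case 0
    with assms show ?case by auto
  next
    case (Suc N)
    then have "K \<noteq> {}" by auto
    then obtain m where m: "m \<in> K" "\<forall>k\<in>K. k = m \<or> k \<lless> m"
      using finite_has_prec_max Suc.prems by blast
    have "s ` K = insert (s m) (s ` (K - {m}))" using m by auto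
    then obtain c where c: "x - scale c (s m) \<in> span (s ` (K - {m}))"
      using Suc.prems span_breakdown_eq by metis
    show ?case
    proof (cases "c = 0")
      case True
      then show ?thesis using Suc.hyps(2) c Suc.prems m
        by (intro Suc.hyps(1)[of "K - {m}"]) auto
    next
      case False
      have "span (s ` (K - {m})) \<subseteq> lower m"
        unfolding lower_def using m Suc.prems by (intro span_mono) auto
      then show ?thesis using False c m Suc.prems unfolding lead_def by blast
    qed
  qed
  moreover have "x \<in> span (s ` \<Lambda>)" using span_s by simp
  then obtain t r where t: "finite t" "t \<subseteq> s ` \<Lambda>" and x: "x = (\<Sum>v\<in>t. scale (r v) v)"
    unfolding span_explicit by blast
  from t obtain K where "K \<subseteq> \<Lambda>" "finite K" "t = s ` K"
    by (meson finite_subset_image)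
  moreover from this have "x \<in> span (s ` K)"
    unfolding x by (intro span_sum span_scale) (auto intro: span_base)
  ultimately show ?thesis using that by blast
qed

lemma no_zero_divisors: "is_domain TYPE('a)"
  unfolding is_domain_def
proof (intro conjI allI impI)
  fix x y :: 'a
  assume "x * y = 0"
  then show "x = 0 \<or> y = 0"
    using lead_exists lead_mult lead_nonzero by metis
qed simp

text \<open>
  Only \<open>0\<close> is possible since \<open>1 = 1 * 1\<close> forces \<open>k + k = k\<close>; this avoids comparing \<open>1\<close> with \<open>s 0\<close>.
\<close>

lemma lead_one: "lead 1 0"
proof -
  obtain k where k: "lead 1 k" using lead_exists[of 1] by auto
  have "lead 1 (k + k)" using lead_mult[OF k k] by simp
  then have "k + k = k" using k by (rule lead_unique)
  with k show ?thesis by simp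
qed

lemma lead_power:
  assumes "lead x m"
  shows "lead (x ^ n) (\<Sum>i<n. m)"
proof (induction n)
  case (Suc n)
  from lead_mult[OF assms Suc] show ?case
    by (simp add: add.commute)
qed (simp add: lead_one)

lemma lead_diff:
  assumes "lead (x - y) k" "lead x m" "lead y n"
  shows "k = m \<or> k \<lless> m \<or> k = n \<or> k \<lless> n"
proof -
  let ?S = "{k\<in>\<Lambda>. k = m \<or> k \<lless> m \<or> k = n \<or> k \<lless> n}"
  have "span (s ` {k\<in>\<Lambda>. k = m \<or> k \<lless> m}) \<subseteq> span (s ` ?S)"
       "span (s ` {k\<in>\<Lambda>. k = n \<or> k \<lless> n}) \<subseteq> span (s ` ?S)"
    by (intro span_mono; auto)+
  then have "x - y \<in> span (s ` ?S)"
    using lead_in_span assms by (blast intro: span_diff)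
  from lead_in_support[OF assms(1) _ this] show ?thesis by auto
qed

lemma lead_cancel:
  assumes "lead x m" "lead y m"
  obtains c where "c \<noteq> 0" "\<And>k. lead (x - scale c y) k \<Longrightarrow> k \<lless> m"
proof -
  obtain a where m: "m \<in> \<Lambda>" and a: "a \<noteq> 0" "x - scale a (s m) \<in> lower m"
    using assms(1) unfolding lead_def by blast
  obtain b where b: "b \<noteq> 0" "y - scale b (s m) \<in> lower m"
    using assms(2) unfolding lead_def by blast
  have "x - scale (a / b) y = (x - scale a (s m)) - scale (a / b) (y - scale b (s m))"
    using b(1) by (simp add: scale_right_diff_distrib)
  also have "\<dots> \<in> lower m"
    using a b unfolding lower_def by (blast intro: span_diff span_scale)
  finally have "k \<lless> m" if "lead (x - scale (a / b) y) k" for k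
    using lead_in_support[OF that, of "{k\<in>\<Lambda>. k \<lless> m}"] unfolding lower_def by blast
  then show ?thesis using that[of "a / b"] a b by simp
qed

lemma lead_scale:
  assumes "lead x m" "c \<noteq> 0"
  shows "lead (scale c x) m"
proof -
  obtain a where m: "m \<in> \<Lambda>" and a: "a \<noteq> 0" "x - scale a (s m) \<in> lower m"
    using assms unfolding lead_def by blast
  have "scale c (x - scale a (s m)) \<in> lower m"
    using a(2) unfolding lower_def by (rule span_scale)
  then show ?thesis unfolding lead_def using m a(1) assms(2)
    by (intro conjI exI[of _ "c * a"]) (auto simp: scale_right_diff_distrib)
qed

lemma lead_basis: "m \<in> \<Lambda> \<Longrightarrow> lead (s m) m"
  unfolding lead_def lower_def by (auto simp: span_zero intro!: exI[of _ 1])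

end

section \<open>Term orders refining the degree\<close>

text \<open>
  Exponents are compared by degree first and by the linear form \<open>l\<close> second; the lexicographic order on the
  exponents themselves only breaks the remaining ties.  Varying \<open>l\<close> probes the top degree part of an element
  in different directions.
\<close>

definition monomial_less ::
    "((nat \<Rightarrow> int) \<Rightarrow> nat \<Rightarrow> nat) \<Rightarrow> ((nat \<Rightarrow> int) \<Rightarrow> int) \<Rightarrow> (nat \<Rightarrow> int) \<Rightarrow> (nat \<Rightarrow> int) \<Rightarrow> bool" where
  "monomial_less d l m m' \<longleftrightarrow>
     less_fun (d m) (d m') \<or> d m = d m' \<and> (l m < l m' \<or> l m = l m' \<and> less_fun m m')"

lemma less_fun_total:
  fixes f g :: "nat \<Rightarrow> 'b::linorder"
  shows "less_fun f g \<or> f = g \<or> less_fun g f"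
proof (rule ccontr)
  assume neg: "\<not> ?thesis"
  define k where "k = (LEAST k. f k \<noteq> g k)"
  from neg obtain j where "f j \<noteq> g j" by auto
  then have "f k \<noteq> g k" unfolding k_def by (rule LeastI)
  moreover have "\<And>j. j < k \<Longrightarrow> f j = g j" unfolding k_def using not_less_Least by blast
  ultimately have "less_fun f g \<or> less_fun g f"
    unfolding less_fun_def by (metis linorder_neqE)
  with neg show False by blast
qed

lemma less_fun_add:
  fixes f g h :: "nat \<Rightarrow> 'b::{ordered_cancel_ab_semigroup_add, linorder}"
  shows "less_fun f g \<Longrightarrow> less_fun (f + h) (g + h)"
  unfolding less_fun_def by (auto intro!: add_strict_right_mono)

lemma wf_less_fun_tuples:
  "wf {(f, g). f \<in> tuples p \<and> g \<in> tuples p \<and> less_fun f (g :: nat \<Rightarrow> nat)}"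
proof (rule wf_subset)
  let ?l = "\<lambda>f. map f [0..<p]"
  show "wf (inv_image (lexn less_than p) ?l)"
    by (intro wf_inv_image wf_lexn) simp
  show "{(f, g). f \<in> tuples p \<and> g \<in> tuples p \<and> less_fun f g} \<subseteq> inv_image (lexn less_than p) ?l"
  proof clarify
    fix f g :: "nat \<Rightarrow> nat"
    assume fg: "f \<in> tuples p" "g \<in> tuples p" "less_fun f g"
    then obtain k where k: "f k < g k" "\<And>j. j < k \<Longrightarrow> f j = g j"
      unfolding less_fun_def by blast
    have "k < p" using fg k(1) unfolding tuples_def by (metis (mono_tags) mem_Collect_eq not_less less_irrefl)
    then have split: "[0..<p] = [0..<k] @ k # [Suc k..<p]"
      by (metis less_imp_le_nat upt_add_eq_append upt_conv_Cons le_add_diff_inverse zero_le)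
    have "?l f = map g [0..<k] @ f k # map f [Suc k..<p]" "?l g = map g [0..<k] @ g k # map g [Suc k..<p]"
      using k(2) unfolding split by auto
    moreover have "(f k, g k) \<in> less_than" using k(1) by simp
    ultimately have "\<exists>xys x y xs ys. ?l f = xys @ x # xs \<and> ?l g = xys @ y # ys \<and> (x, y) \<in> less_than"
      by blast
    then show "(f, g) \<in> inv_image (lexn less_than p) ?l"
      by (simp only: in_inv_image lexn_conv mem_Collect_eq case_prod_conv) simp
  qed
qed

lemma monomial_less_same_degree:
  "u = v \<or> monomial_less d l u v \<Longrightarrow> d u = d v \<Longrightarrow> l u \<le> l v"
  unfolding monomial_less_def using less_fun_irrefl by auto

lemma int_le_0_if_multiples_bounded:
  fixes x y :: int
  assumes "\<And>n. int n * x \<le> y"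
  shows "x \<le> 0"
proof (rule ccontr)
  assume "\<not> x \<le> 0"
  then have "1 \<le> x" by simp
  define n where "n = nat (\<bar>y\<bar> + 1)"
  have "int n * 1 \<le> int n * x" using \<open>1 \<le> x\<close> by (intro mult_left_mono) auto
  also have "\<dots> \<le> y" by (rule assms)
  finally show False by (simp add: n_def)
qed

lemma finite_tuples_bounded:
  fixes lo hi :: "nat \<Rightarrow> int"
  shows "finite {m \<in> tuples r. \<forall>i<r. lo i \<le> m i \<and> m i \<le> hi i}"
proof (rule finite_subset)
  show "finite {m. \<forall>i. (i \<in> {..<r} \<longrightarrow> m i \<in> (\<Union>i<r. {lo i..hi i})) \<and> (i \<notin> {..<r} \<longrightarrow> m i = (0::int))}"
    by (intro finite_set_of_finite_funs) auto
qed (auto simp: tuples_def)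

section \<open>Division in the filtered algebra\<close>

locale monomial_filtration = complex_algebra scale
  for scale :: "complex \<Rightarrow> 'a::ring_1 \<Rightarrow> 'a" +
  fixes r p :: nat and \<Lambda> :: "(nat \<Rightarrow> int) set" and s :: "(nat \<Rightarrow> int) \<Rightarrow> 'a"
    and deg :: "(nat \<Rightarrow> int) \<Rightarrow> nat \<Rightarrow> nat" and q :: complex
    and C :: "(nat \<Rightarrow> int) \<Rightarrow> (nat \<Rightarrow> int) \<Rightarrow> int"
  assumes \<Lambda>_tuples: "\<Lambda> \<subseteq> tuples r"
    and \<Lambda>_submonoid: "add_submonoid \<Lambda>"
    and \<Lambda>_fin_gen: "fin_gen_submonoid \<Lambda>"
    and \<Lambda>_primitive: "primitive_in_completion \<Lambda>"
    and inj_s: "inj_on s \<Lambda>"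
    and independent_s: "\<not> dependent (s ` \<Lambda>)"
    and span_s: "span (s ` \<Lambda>) = UNIV"
    and deg_tuples: "m \<in> \<Lambda> \<Longrightarrow> deg m \<in> tuples p"
    and deg_add: "m \<in> \<Lambda> \<Longrightarrow> m' \<in> \<Lambda> \<Longrightarrow> deg (m + m') = deg m + deg m'"
    and q_nonzero: "q \<noteq> 0"
    and mult_s: "m \<in> \<Lambda> \<Longrightarrow> m' \<in> \<Lambda> \<Longrightarrow>
           s m * s m' - scale (q powi C m m') (s (m + m'))
             \<in> filtration_less scale \<Lambda> s deg (deg m + deg m')"
begin

lemma leading_exponents_monomial_less:
  assumes "additive l"
  shows "leading_exponents scale \<Lambda> s (monomial_less deg l)"
proof
  show "m + n \<in> \<Lambda>" if "m \<in> \<Lambda>" "n \<in> \<Lambda>" for m n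
    using that \<Lambda>_submonoid unfolding add_submonoid_def by blast
  show "inj_on s \<Lambda>" "\<not> dependent (s ` \<Lambda>)" "span (s ` \<Lambda>) = UNIV"
    by (fact inj_s independent_s span_s)+
  show "\<not> monomial_less deg l m m" for m
    by (simp add: monomial_less_def less_fun_irrefl)
  show "monomial_less deg l k n" if "monomial_less deg l k m" "monomial_less deg l m n" for k m n
    using that less_fun_trans unfolding monomial_less_def by (metis less_trans)
  show "monomial_less deg l m n \<or> m = n \<or> monomial_less deg l n m" for m n
    unfolding monomial_less_def using less_fun_total[of "deg m" "deg n"] less_fun_total[of m n]
    by (metis linorder_neqE)
  show "monomial_less deg l (m + k) (n + k)"
    if "k \<in> \<Lambda>" "m \<in> \<Lambda>" "n \<in> \<Lambda>" "monomial_less deg l m n" for k m n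
    using that less_fun_add[of "deg m" "deg n" "deg k"] less_fun_add[of m n k]
    by (auto simp: monomial_less_def deg_add additive.add[OF assms])
  show "\<exists>c. c \<noteq> 0 \<and> s m * s n - scale c (s (m + n)) \<in> span (s ` {k \<in> \<Lambda>. monomial_less deg l k (m + n)})"
    if "m \<in> \<Lambda>" "n \<in> \<Lambda>" for m n
  proof (intro exI conjI)
    show "q powi C m n \<noteq> 0" using q_nonzero by simp
    have "filtration_less scale \<Lambda> s deg (deg m + deg n)
        \<subseteq> span (s ` {k \<in> \<Lambda>. monomial_less deg l k (m + n)})"
      unfolding filtration_less_def using that
      by (intro span_mono image_mono) (auto simp: monomial_less_def deg_add)
    then show "s m * s n - scale (q powi C m n) (s (m + n))
        \<in> span (s ` {k \<in> \<Lambda>. monomial_less deg l k (m + n)})"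
      using mult_s[OF that] by blast
  qed
qed

abbreviation leads :: "((nat \<Rightarrow> int) \<Rightarrow> int) \<Rightarrow> 'a \<Rightarrow> (nat \<Rightarrow> int) \<Rightarrow> bool" where
  "leads l \<equiv> leading_exponents.lead scale \<Lambda> s (monomial_less deg l)"

lemma additive_zero: "additive (\<lambda>_::nat \<Rightarrow> int. 0 :: int)"
  by unfold_locales simp

\<comment> \<open>The order for \<open>l = 0\<close> steers the division; other linear forms only provide bounds.\<close>
interpretation Z: leading_exponents scale \<Lambda> s "monomial_less deg (\<lambda>_. 0)"
  by (rule leading_exponents_monomial_less[OF additive_zero])

lemma leading_degree_unique:
  assumes "additive l" "additive l'" "leads l x m" "leads l' x n"
  shows "deg m = deg n"
proof -
  interpret L: leading_exponents scale \<Lambda> s "monomial_less deg l"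
    by (rule leading_exponents_monomial_less[OF assms(1)])
  interpret L': leading_exponents scale \<Lambda> s "monomial_less deg l'"
    by (rule leading_exponents_monomial_less[OF assms(2)])
  have "n = m \<or> monomial_less deg l n m"
    using L'.lead_in_support[OF assms(4) _ L.lead_in_span[OF assms(3)]] by auto
  moreover have "m = n \<or> monomial_less deg l' m n"
    using L.lead_in_support[OF assms(3) _ L'.lead_in_span[OF assms(4)]] by auto
  ultimately show ?thesis
    unfolding monomial_less_def using less_fun_asym by metis
qed

text \<open>
  The leading exponent for \<open>l'\<close> maximises \<open>l'\<close> among the exponents of top degree, and the leading exponent
  for any other linear form is one of these.
\<close>

lemma leading_form_maximal:
  assumes "additive l" "additive l'" "leads l x m" "leads l' x n"
  shows "l' m \<le> l' n"
proof -
  interpret L: leading_exponents scale \<Lambda> s "monomial_less deg l"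
    by (rule leading_exponents_monomial_less[OF assms(1)])
  interpret L': leading_exponents scale \<Lambda> s "monomial_less deg l'"
    by (rule leading_exponents_monomial_less[OF assms(2)])
  have "m = n \<or> monomial_less deg l' m n"
    using L.lead_in_support[OF assms(3) _ L'.lead_in_span[OF assms(4)]] by auto
  then show ?thesis
    using leading_degree_unique[OF assms] by (rule monomial_less_same_degree)
qed

text \<open>
  For central \<open>z\<close> and \<open>b = a / z\<close> the fourth hypothesis says \<open>b^n = c / z\<close>, so that the exponent of \<open>c\<close> is that of \<open>z\<close> plus \<open>n\<close> times
  that of \<open>b\<close>.
\<close>

lemma leads_power_quotient:
  assumes "additive l" "leads l a u" "leads l z w" "a ^ n * z = z ^ n * c" "leads l c e"
  shows "e = w + (\<Sum>i<n. u - w)"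
proof -
  interpret L: leading_exponents scale \<Lambda> s "monomial_less deg l"
    by (rule leading_exponents_monomial_less[OF assms(1)])
  have "leads l (a ^ n * z) ((\<Sum>i<n. u) + w)"
    using L.lead_mult[OF L.lead_power assms(3)] assms(2) by blast
  moreover have "leads l (a ^ n * z) ((\<Sum>i<n. w) + e)"
    unfolding assms(4) using L.lead_mult[OF L.lead_power assms(5)] assms(3) by blast
  ultimately have "(\<Sum>i<n. u) + w = (\<Sum>i<n. w) + e"
    by (rule L.lead_unique)
  then show ?thesis by (simp add: sum_subtractf algebra_simps)
qed

text \<open>
  Here \<open>m - k\<close> is the exponent of \<open>b = a / z\<close>, all of whose powers have denominator \<open>z\<close>.  Hence \<open>k + n (m - k)\<close>
  is an exponent of \<open>z b^n\<close> for every \<open>n\<close>, and complete integral closedness puts \<open>m - k\<close> into \<open>\<Lambda>\<close>.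

  The second part says that translating the top degree part of \<open>z\<close> by \<open>m - k\<close> does not leave the Newton
  polytope of the top degree part of \<open>a\<close>.  For a single pair \<open>a\<close>, \<open>z\<close> this can fail, so all powers are needed:
  the support function of \<open>z b^n\<close> is that of \<open>z\<close> plus \<open>n\<close> times the difference \<open>l u - l w\<close>, and its value bounds
  \<open>l\<close> at the exponent \<open>k + n (m - k)\<close>; dividing by \<open>n\<close> removes the terms that do not grow with \<open>n\<close>.
\<close>

lemma quotient_exponent:
  assumes powers: "\<And>n. \<exists>c. a ^ n * z = z ^ n * c"
    and a: "leads (\<lambda>_. 0) a m" and z: "leads (\<lambda>_. 0) z k"
  shows quotient_exponent_mem: "m - k \<in> \<Lambda>"
    and quotient_exponent_bound:
      "additive l \<Longrightarrow> leads l a u \<Longrightarrow> leads l z w \<Longrightarrow> l (m - k) + l w \<le> l u"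
proof -
  have ex: "\<exists>c e. a ^ n * z = z ^ n * c \<and> c \<noteq> 0 \<and> leads (\<lambda>_. 0) c e" for n
  proof -
    obtain c where c: "a ^ n * z = z ^ n * c" using powers by blast
    have "a ^ n * z \<noteq> 0"
      using Z.lead_mult[OF Z.lead_power[OF a] z] by (rule Z.lead_nonzero)
    then have "c \<noteq> 0" using c by auto
    with c Z.lead_exists[OF this] show ?thesis by blast
  qed
  have "k + (\<Sum>i<n. m - k) \<in> \<Lambda>" for n :: nat
  proof -
    obtain c e where c: "a ^ n * z = z ^ n * c" "leads (\<lambda>_. 0) c e" using ex by blast
    show ?thesis
      using leads_power_quotient[OF additive_zero a z c] Z.lead_mem[OF c(2)] by simp
  qed
  moreover have "m - k \<in> group_completion \<Lambda>"
    using Z.lead_mem a z unfolding group_completion_def by blast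
  ultimately show "m - k \<in> \<Lambda>"
    using primitive_add_multiples[OF \<Lambda>_submonoid \<Lambda>_fin_gen \<Lambda>_primitive] by blast
  show "l (m - k) + l w \<le> l u" if l: "additive l" and u: "leads l a u" and w: "leads l z w"
  proof -
    interpret L: leading_exponents scale \<Lambda> s "monomial_less deg l"
      by (rule leading_exponents_monomial_less[OF l])
    have l_multiple: "l (\<Sum>i<n. x) = int n * l x" for x and n :: nat
      unfolding additive.sum[OF l] by simp
    have "int n * (l (m - k) - l (u - w)) \<le> l w - l k" for n
    proof -
      obtain c e where c: "a ^ n * z = z ^ n * c" "c \<noteq> 0" "leads (\<lambda>_. 0) c e" using ex by blast
      obtain e' where e': "leads l c e'" using L.lead_exists[OF c(2)] by blast
      have "l e \<le> l e'" by (rule leading_form_maximal[OF additive_zero l c(3) e'])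
      then show ?thesis
        unfolding leads_power_quotient[OF additive_zero a z c(1,3)] leads_power_quotient[OF l u w c(1) e']
        by (simp only: additive.add[OF l] l_multiple) (simp add: algebra_simps)
    qed
    then have "l (m - k) - l (u - w) \<le> 0" by (rule int_le_0_if_multiples_bounded)
    then show ?thesis by (simp add: additive.diff[OF l])
  qed
qed

text \<open>
  One step of long division by \<open>z\<close>.  The leading exponent drops, and as long as the degree does not, no linear
  form takes a larger value on the exponents of top degree than before.
\<close>

lemma subtract_leading_multiple:
  assumes z: "leads (\<lambda>_. 0) z k" and a: "leads (\<lambda>_. 0) a m"
    and powers: "\<And>n. \<exists>c. a ^ n * z = z ^ n * c"
  obtains x where "\<And>m'. leads (\<lambda>_. 0) (a - x * z) m' \<Longrightarrow> monomial_less deg (\<lambda>_. 0) m' m"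
    and "\<And>l u u'. additive l \<Longrightarrow> leads l a u \<Longrightarrow> leads l (a - x * z) u' \<Longrightarrow> deg u' = deg u \<Longrightarrow> l u' \<le> l u"
proof -
  define j where "j = m - k"
  have j: "j \<in> \<Lambda>" unfolding j_def by (rule quotient_exponent_mem[OF powers a z])
  have "leads (\<lambda>_. 0) (s j * z) m"
    using Z.lead_mult[OF Z.lead_basis[OF j] z] by (simp add: j_def)
  then obtain c where c: "c \<noteq> 0"
    and less: "\<And>m'. leads (\<lambda>_. 0) (a - scale c (s j * z)) m' \<Longrightarrow> monomial_less deg (\<lambda>_. 0) m' m"
    using Z.lead_cancel[OF a] by blast
  have eq: "scale c (s j * z) = scale c (s j) * z" by (simp add: scale_mult_left)
  have "l u' \<le> l u"
    if l: "additive l" and u: "leads l a u" and u': "leads l (a - scale c (s j) * z) u'"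
      and deg: "deg u' = deg u" for l u u'
  proof -
    interpret L: leading_exponents scale \<Lambda> s "monomial_less deg l"
      by (rule leading_exponents_monomial_less[OF l])
    obtain w where w: "leads l z w"
      using L.lead_exists Z.lead_nonzero[OF z] by blast
    have "leads l (scale c (s j) * z) (j + w)"
      using L.lead_mult[OF L.lead_scale[OF L.lead_basis[OF j] c] w] .
    from L.lead_diff[OF u' u this]
    consider "u' = u \<or> monomial_less deg l u' u" | "u' = j + w \<or> monomial_less deg l u' (j + w)"
      by blast
    then show ?thesis
    proof cases
      case 1
      then show ?thesis using deg by (rule monomial_less_same_degree)
    next
      case 2
      have "deg (j + w) = deg j + deg k"
        using deg_add j L.lead_mem[OF w] leading_degree_unique[OF l additive_zero w z] by simp
      also have "\<dots> = deg m"
        using deg_add[OF j Z.lead_mem[OF z]] by (simp add: j_def)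
      also have "\<dots> = deg u'"
        using leading_degree_unique[OF l additive_zero u a] deg by simp
      finally have "l u' \<le> l (j + w)" using 2 monomial_less_same_degree by metis
      also have "\<dots> \<le> l u"
        using quotient_exponent_bound[OF powers a z l u w] by (simp add: j_def additive.add[OF l])
      finally show ?thesis .
    qed
  qed
  with less show ?thesis unfolding eq by (rule that)
qed

text \<open>
  Long division by \<open>z\<close> stops.  The degrees are well-ordered, so only steps that keep the degree have to be
  bounded.  Applied to the coordinate functions and their negatives, the previous lemma keeps the exponents of
  top degree in the coordinate box spanned by those of the initial \<open>a\<close>; a box contains finitely many lattice
  points, and the leading exponent strictly decreases among them.
\<close>

lemma division_terminates:
  assumes z: "z \<noteq> (0 :: 'a)"
    and add: "\<And>a x. a \<in> T \<Longrightarrow> a + x * z \<in> T"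
    and powers: "\<And>a n. a \<in> T \<Longrightarrow> \<exists>c. a ^ n * z = z ^ n * c"
  shows "T \<subseteq> range (\<lambda>x. x * z)"
proof -
  let ?R = "range (\<lambda>x. x * z)"
  obtain k where k: "leads (\<lambda>_. 0) z k" using Z.lead_exists[OF z] .
  have reduce: "a - x * z \<in> T" "a - x * z \<in> ?R \<Longrightarrow> a \<in> ?R" if "a \<in> T" for a x
  proof -
    show "a - x * z \<in> T" using add[OF that, of "- x"] by simp
    assume "a - x * z \<in> ?R"
    then obtain y where "a - x * z = y * z" by blast
    then have "a = (x + y) * z" by (simp add: algebra_simps)
    then show "a \<in> ?R" by (rule range_eqI)
  qed
  have main: "a \<in> ?R" if "a \<in> T" "leads (\<lambda>_. 0) a m" "deg m = D" for a m D
    using that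
  proof (induction D arbitrary: a m rule: wf_induct_rule[OF wf_less_fun_tuples[of p]])
    case (1 D a m)
    note outer = 1(1) and a0 = 1(2,3) and D = 1(4)
    \<comment> \<open>A bound for a coordinate and one for its negative confine it to an interval.\<close>
    define coords :: "((nat \<Rightarrow> int) \<Rightarrow> int) set" where
      "coords = (\<lambda>i m. m i) ` {..<r} \<union> (\<lambda>i m. - m i) ` {..<r}"
    have coords_additive: "additive l" if "l \<in> coords" for l
      using that unfolding coords_def by (auto intro!: additive.intro)
    have ex: "\<exists>u. leads l a u" if "l \<in> coords" for l
    proof -
      interpret L: leading_exponents scale \<Lambda> s "monomial_less deg l"
        by (rule leading_exponents_monomial_less[OF coords_additive[OF that]])
      show ?thesis using L.lead_exists Z.lead_nonzero[OF a0(2)] by blast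
    qed
    define H where "H l = l (SOME u. leads l a u)" for l :: "(nat \<Rightarrow> int) \<Rightarrow> int"
    have H: "l u = H l" if "l \<in> coords" "leads l a u" for l u
    proof -
      interpret L: leading_exponents scale \<Lambda> s "monomial_less deg l"
        by (rule leading_exponents_monomial_less[OF coords_additive[OF that(1)]])
      show ?thesis using L.lead_unique[OF that(2) someI[of "leads l a", OF that(2)]] by (simp add: H_def)
    qed
    \<comment> \<open>The coordinate box; in one degree all leading exponents met below lie in it.\<close>
    define K where "K = {n\<in>\<Lambda>. \<forall>l\<in>coords. l n \<le> H l}"
    have "K \<subseteq> {n \<in> tuples r. \<forall>i<r. - H (\<lambda>m. - m i) \<le> n i \<and> n i \<le> H (\<lambda>m. m i)}"
      unfolding K_def coords_def using \<Lambda>_tuples by force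
    then have K: "finite K" using finite_tuples_bounded by (rule finite_subset)
    have K_mem: "n \<in> K"
      if n: "leads (\<lambda>_. 0) b n" and bound: "\<And>l u. l \<in> coords \<Longrightarrow> leads l b u \<Longrightarrow> l u \<le> H l" for b n
    proof -
      have "l n \<le> H l" if l: "l \<in> coords" for l
      proof -
        interpret L: leading_exponents scale \<Lambda> s "monomial_less deg l"
          by (rule leading_exponents_monomial_less[OF coords_additive[OF l]])
        obtain u where u: "leads l b u"
          using L.lead_exists Z.lead_nonzero[OF n] by blast
        have "l n \<le> l u"
          by (rule leading_form_maximal[OF additive_zero coords_additive[OF l] n u])
        also have "\<dots> \<le> H l" using l u by (rule bound)
        finally show ?thesis .
      qed
      then show ?thesis using Z.lead_mem[OF n] unfolding K_def by blast
    qed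
    have "b \<in> ?R"
      if "b \<in> T" "leads (\<lambda>_. 0) b n" "deg n = deg m"
        "\<And>l u. l \<in> coords \<Longrightarrow> leads l b u \<Longrightarrow> l u \<le> H l" for b n
      using that
    \<comment> \<open>The position of the leading exponent among the points of the box measures the progress.\<close>
    proof (induction "card {j\<in>K. monomial_less deg (\<lambda>_. 0) j n}" arbitrary: b n rule: less_induct)
      case less
      note b = less.prems(1,2)
      obtain x where x: "\<And>n'. leads (\<lambda>_. 0) (b - x * z) n' \<Longrightarrow> monomial_less deg (\<lambda>_. 0) n' n"
        "\<And>l u u'. additive l \<Longrightarrow> leads l b u \<Longrightarrow> leads l (b - x * z) u' \<Longrightarrow> deg u' = deg u \<Longrightarrow> l u' \<le> l u"
        using subtract_leading_multiple[OF k b(2) powers[OF b(1)]] by blast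
      define b' where "b' = b - x * z"
      have b'T: "b' \<in> T" unfolding b'_def by (rule reduce(1)[OF b(1)])
      have "b' \<in> ?R"
      proof (cases "b' = 0")
        case True
        then have "b' = 0 * z" by simp
        then show ?thesis by (rule range_eqI)
      next
        case False
        then obtain n' where n': "leads (\<lambda>_. 0) b' n'" using Z.lead_exists by blast
        have n'_less: "monomial_less deg (\<lambda>_. 0) n' n" using x(1) n' unfolding b'_def .
        show ?thesis
        proof (cases "deg n' = deg n")
          case False
          then have "less_fun (deg n') D"
            using n'_less less.prems(3) D unfolding monomial_less_def by simp
          moreover have "deg n' \<in> tuples p" "D \<in> tuples p"
            using deg_tuples[OF Z.lead_mem] n' a0(2) D by auto
          ultimately show ?thesis
            using outer[OF _ b'T n' refl] by simp
        next
          case True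
          have bound: "l u' \<le> H l" if l: "l \<in> coords" and u': "leads l b' u'" for l u'
          proof -
            interpret L: leading_exponents scale \<Lambda> s "monomial_less deg l"
              by (rule leading_exponents_monomial_less[OF coords_additive[OF l]])
            obtain u where u: "leads l b u"
              using L.lead_exists Z.lead_nonzero[OF b(2)] by blast
            note add_l = coords_additive[OF l]
            have "deg u' = deg u"
              using leading_degree_unique[OF add_l additive_zero u' n']
                leading_degree_unique[OF add_l additive_zero u b(2)] True by simp
            then have "l u' \<le> l u" using x(2)[OF add_l u] u' unfolding b'_def by blast
            also have "\<dots> \<le> H l" using less.prems(4) l u by blast
            finally show ?thesis .
          qed
          have "{j\<in>K. monomial_less deg (\<lambda>_. 0) j n'} \<subset> {j\<in>K. monomial_less deg (\<lambda>_. 0) j n}"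
            using K_mem[OF n' bound] n'_less Z.prec_trans[OF _ n'_less] Z.prec_irrefl[of n'] by blast
          then have card: "card {j\<in>K. monomial_less deg (\<lambda>_. 0) j n'} < card {j\<in>K. monomial_less deg (\<lambda>_. 0) j n}"
            using K by (intro psubset_card_mono) auto
          show ?thesis
            by (rule less.hyps[OF card b'T n' trans[OF True less.prems(3)] bound])
        qed
      qed
      then show ?case unfolding b'_def by (rule reduce(2)[OF b(1)])
    qed
    from this[OF a0 refl] H show ?case by (metis order_refl)
  qed
  show ?thesis
  proof
    fix a assume "a \<in> T"
    show "a \<in> ?R"
    proof (cases "a = 0")
      case True
      then have "a = 0 * z" by simp
      then show ?thesis by (rule range_eqI)
    next
      case False
      then obtain m where "leads (\<lambda>_. 0) a m" using Z.lead_exists by blast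
      with \<open>a \<in> T\<close> show ?thesis by (rule main) (rule refl)
    qed
  qed
qed

lemma no_zero_divisors: "is_domain TYPE('a)"
  by (rule Z.no_zero_divisors)

end

section \<open>The central quotient ring of a domain\<close>


context
  assumes dom: "is_domain TYPE('a::ring_1)"
begin

lemma mult_eq_0D: "x * y = 0 \<Longrightarrow> x = 0 \<or> y = (0::'a)"
  using dom unfolding is_domain_def by blast

lemma right_cancel: "z \<noteq> 0 \<Longrightarrow> x * z = y * z \<Longrightarrow> x = (y::'a)"
  using mult_eq_0D[of "x - y" z] by (simp add: left_diff_distrib)

lemma nonzero_mult: "x \<noteq> 0 \<Longrightarrow> y \<noteq> 0 \<Longrightarrow> x * y \<noteq> (0::'a)"
  using mult_eq_0D by blast

lemma center_mult: "z \<in> center \<Longrightarrow> w \<in> center \<Longrightarrow> z * w \<in> (center :: 'a set)"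
proof -
  assume "z \<in> center" "w \<in> center"
  then have z: "z * x = x * z" and w: "w * x = x * w" for x unfolding center_def by auto
  have "(z * w) * x = x * (z * w)" for x
    unfolding mult.assoc w[of x] z[of "x * w"] by (simp only: mult.assoc z[of w])
  then show ?thesis unfolding center_def by blast
qed

lemma center_add: "z \<in> center \<Longrightarrow> w \<in> center \<Longrightarrow> z + w \<in> (center :: 'a set)"
  unfolding center_def by (simp add: algebra_simps)

lemma center_one: "1 \<in> (center :: 'a set)"
  unfolding center_def by simp

lemma center_nonzero_mult:
  "z \<in> center - {0} \<Longrightarrow> w \<in> center - {0} \<Longrightarrow> z * w \<in> (center - {0} :: 'a set)"
  using center_mult mult_eq_0D by blast

lemma center_commute: "z \<in> center \<Longrightarrow> z * x = x * (z::'a)"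
  unfolding center_def by blast

lemma center_left_commute: "z \<in> center \<Longrightarrow> x * (z * y) = z * (x * (y::'a))"
proof -
  assume "z \<in> center"
  then have "(x * z) * y = (z * x) * y" by (simp only: center_commute)
  then show ?thesis by (simp only: mult.assoc)
qed

lemma center_fract_eq_iff:
  assumes "a \<in> center" "b \<in> center" "z \<in> center - {0}" "w \<in> center - {0}"
  shows "center_fract a z = center_fract b w \<longleftrightarrow> a * w = b * (z::'a)"
proof
  assume "center_fract a z = center_fract b w"
  moreover have "(b, w) \<in> center_fract b w" using assms by (simp add: center_fract_def)
  ultimately have "(b, w) \<in> center_fract a z" by simp
  then show "a * w = b * z" by (simp add: center_fract_def)
next
  assume eq: "a * w = b * z"
  have "a * v = c * z \<longleftrightarrow> b * v = c * w" if "c \<in> center" "v \<in> center" for c v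
  proof -
    have "(a * v) * w = (a * w) * v"
      using that assms center_commute[of v w] by (simp add: mult.assoc)
    also have "\<dots> = (b * v) * z"
      unfolding eq using that assms center_commute[of v z] by (simp add: mult.assoc)
    finally have 1: "(a * v) * w = (b * v) * z" .
    have 2: "(c * z) * w = (c * w) * z"
      using assms center_commute[of z w] by (simp add: mult.assoc)
    show ?thesis
      using 1 2 right_cancel assms by (metis Diff_iff singletonI)
  qed
  then show "center_fract a z = center_fract b w"
    unfolding center_fract_def by auto
qed

lemma center_fract_cases:
  assumes "x \<in> carrier center_fraction_field"
  obtains a z where "a \<in> center" "z \<in> (center - {0} :: 'a set)" "x = center_fract a z"
  using assms unfolding center_fraction_field_def by auto

lemma UN_UN_eq_const:
  assumes "(a0, z0) \<in> X" "(b0, w0) \<in> Y"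
    and "\<And>a z b w. (a, z) \<in> X \<Longrightarrow> (b, w) \<in> Y \<Longrightarrow> F a z b w = c"
  shows "(\<Union>(a, z)\<in>X. \<Union>(b, w)\<in>Y. F a z b w) = c"
  using assms by fast

lemmas center_ac = center_commute center_left_commute mult.assoc

lemma center_fract_closed:
  "a \<in> center \<Longrightarrow> z \<in> (center - {0} :: 'a set) \<Longrightarrow> center_fract a z \<in> carrier center_fraction_field"
  unfolding center_fraction_field_def by auto

lemma center_fract_mult:
  assumes "a \<in> center" "b \<in> center" "z \<in> (center - {0} :: 'a set)" "w \<in> center - {0}"
  shows "center_fract a z \<otimes>\<^bsub>center_fraction_field\<^esub> center_fract b w = center_fract (a * b) (z * w)"
proof -
  have rep: "center_fract (a' * b') (z' * w') = center_fract (a * b) (z * w)"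
    if "(a', z') \<in> center_fract a z" "(b', w') \<in> center_fract b w" for a' z' b' w'
  proof -
    have c: "a' \<in> center" "z' \<in> center - {0}" "a * z' = a' * z"
        "b' \<in> center" "w' \<in> center - {0}" "b * w' = b' * w"
      using that unfolding center_fract_def by auto
    have "(a' * b') * (z * w) = (a' * z) * (b' * w)"
      using assms c by (simp add: center_ac)
    also have "\<dots> = (a * b) * (z' * w')"
      unfolding c(3,6)[symmetric] using assms c(1,2,4,5) by (simp add: center_ac)
    finally show ?thesis
      using assms c by (intro center_fract_eq_iff[THEN iffD2] center_mult center_nonzero_mult) auto
  qed
  have "(a, z) \<in> center_fract a z" "(b, w) \<in> center_fract b w"
    using assms by (auto simp: center_fract_def)
  then have "(\<Union>(a, z)\<in>center_fract a z. \<Union>(b, w)\<in>center_fract b w. center_fract (a * b) (z * w)) = center_fract (a * b) (z * w)"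
    by (rule UN_UN_eq_const) (rule rep)
  then show ?thesis
    by (simp add: center_fraction_field_def)
qed

lemma center_fract_add:
  assumes "a \<in> center" "b \<in> center" "z \<in> (center - {0} :: 'a set)" "w \<in> center - {0}"
  shows "center_fract a z \<oplus>\<^bsub>center_fraction_field\<^esub> center_fract b w
    = center_fract (a * w + b * z) (z * w)"
proof -
  have rep: "center_fract (a' * w' + b' * z') (z' * w') = center_fract (a * w + b * z) (z * w)"
    if "(a', z') \<in> center_fract a z" "(b', w') \<in> center_fract b w" for a' z' b' w'
  proof -
    have c: "a' \<in> center" "z' \<in> center - {0}" "a * z' = a' * z"
        "b' \<in> center" "w' \<in> center - {0}" "b * w' = b' * w"
      using that unfolding center_fract_def by auto
    have "(a' * w') * (z * w) = (a' * z) * (w * w')"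
      using assms c(1,2,4,5) by (simp add: center_ac)
    also have "\<dots> = (a * w) * (z' * w')"
      unfolding c(3)[symmetric] using assms c(1,2,4,5) by (simp add: center_ac)
    finally have 1: "(a' * w') * (z * w) = (a * w) * (z' * w')" .
    have "(b' * z') * (z * w) = (b' * w) * (z * z')"
      using assms c(1,2,4,5) by (simp add: center_ac)
    also have "\<dots> = (b * z) * (z' * w')"
      unfolding c(6)[symmetric] using assms c(1,2,4,5) by (simp add: center_ac)
    finally have 2: "(b' * z') * (z * w) = (b * z) * (z' * w')" .
    show ?thesis
      using assms c 1 2
      by (intro center_fract_eq_iff[THEN iffD2] center_mult center_add center_nonzero_mult)
         (auto simp: distrib_right)
  qed
  have "(a, z) \<in> center_fract a z" "(b, w) \<in> center_fract b w"
    using assms by (auto simp: center_fract_def)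
  then have "(\<Union>(a, z)\<in>center_fract a z. \<Union>(b, w)\<in>center_fract b w. center_fract (a * w + b * z) (z * w)) = center_fract (a * w + b * z) (z * w)"
    by (rule UN_UN_eq_const) (rule rep)
  then show ?thesis
    by (simp add: center_fraction_field_def)
qed

lemma fraction_add_closed:
  assumes "x \<in> carrier (center_fraction_field :: ('a \<times> 'a) set ring)" "y \<in> carrier center_fraction_field"
  shows "x \<oplus>\<^bsub>center_fraction_field\<^esub> y \<in> carrier center_fraction_field"
  using assms
  by (elim center_fract_cases)
     (simp only: center_fract_add, intro center_fract_closed center_add center_mult center_nonzero_mult, auto)

lemma fraction_mult_closed:
  assumes "x \<in> carrier (center_fraction_field :: ('a \<times> 'a) set ring)" "y \<in> carrier center_fraction_field"
  shows "x \<otimes>\<^bsub>center_fraction_field\<^esub> y \<in> carrier center_fraction_field"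
  using assms
  by (elim center_fract_cases)
     (simp only: center_fract_mult, intro center_fract_closed center_add center_mult center_nonzero_mult, auto)

lemma fraction_mult_commute:
  assumes "x \<in> carrier (center_fraction_field :: ('a \<times> 'a) set ring)" "y \<in> carrier center_fraction_field"
  shows "x \<otimes>\<^bsub>center_fraction_field\<^esub> y = y \<otimes>\<^bsub>center_fraction_field\<^esub> x"
proof -
  from assms(1) obtain a z where
    x: "a \<in> center" "z \<in> center - {0}" "x = center_fract a z"
    by (rule center_fract_cases)
  from assms(2) obtain b w where
    y: "b \<in> center" "w \<in> center - {0}" "y = center_fract b w"
    by (rule center_fract_cases)
  then show ?thesis
    using center_commute[of a b] center_commute[of z w] x y by (simp add: center_fract_mult)
qed

lemma fraction_mult_assoc:
  assumes "x \<in> carrier (center_fraction_field :: ('a \<times> 'a) set ring)" "y \<in> carrier center_fraction_field"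
    "u \<in> carrier center_fraction_field"
  shows "(x \<otimes>\<^bsub>center_fraction_field\<^esub> y) \<otimes>\<^bsub>center_fraction_field\<^esub> u
    = x \<otimes>\<^bsub>center_fraction_field\<^esub> (y \<otimes>\<^bsub>center_fraction_field\<^esub> u)"
proof -
  from assms(1) obtain a z where
    x: "a \<in> center" "z \<in> center - {0}" "x = center_fract a z"
    by (rule center_fract_cases)
  from assms(2) obtain b w where
    y: "b \<in> center" "w \<in> center - {0}" "y = center_fract b w"
    by (rule center_fract_cases)
  from assms(3) obtain c v where
    u: "c \<in> center" "v \<in> center - {0}" "u = center_fract c v"
    by (rule center_fract_cases)
  then show ?thesis
    using x y center_mult center_nonzero_mult by (simp add: center_fract_mult mult.assoc)
qed

lemma fraction_distrib:
  assumes "x \<in> carrier (center_fraction_field :: ('a \<times> 'a) set ring)" "y \<in> carrier center_fraction_field"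
    "u \<in> carrier center_fraction_field"
  shows "(x \<oplus>\<^bsub>center_fraction_field\<^esub> y) \<otimes>\<^bsub>center_fraction_field\<^esub> u
    = (x \<otimes>\<^bsub>center_fraction_field\<^esub> u) \<oplus>\<^bsub>center_fraction_field\<^esub> (y \<otimes>\<^bsub>center_fraction_field\<^esub> u)"
proof -
  from assms(1) obtain a z where
    x: "a \<in> center" "z \<in> center - {0}" "x = center_fract a z"
    by (rule center_fract_cases)
  from assms(2) obtain b w where
    y: "b \<in> center" "w \<in> center - {0}" "y = center_fract b w"
    by (rule center_fract_cases)
  from assms(3) obtain c v where
    u: "c \<in> center" "v \<in> center - {0}" "u = center_fract c v"
    by (rule center_fract_cases)
  note * = x y u
  have "((a * w + b * z) * c) * ((z * v) * (w * v)) = (a * c * (w * v) + b * c * (z * v)) * (z * w * v)"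
    using * by (simp add: distrib_left distrib_right center_ac)
  then show ?thesis
    unfolding * using *
    by (simp add: center_fract_mult center_fract_add center_fract_eq_iff center_mult center_add nonzero_mult)
qed


lemma fraction_distrib_left:
  assumes "x \<in> carrier (center_fraction_field :: ('a \<times> 'a) set ring)" "y \<in> carrier center_fraction_field"
    "u \<in> carrier center_fraction_field"
  shows "u \<otimes>\<^bsub>center_fraction_field\<^esub> (x \<oplus>\<^bsub>center_fraction_field\<^esub> y)
    = (u \<otimes>\<^bsub>center_fraction_field\<^esub> x) \<oplus>\<^bsub>center_fraction_field\<^esub> (u \<otimes>\<^bsub>center_fraction_field\<^esub> y)"
  using assms fraction_distrib[OF assms] by (simp add: fraction_mult_commute fraction_add_closed)

lemma formal_tensors_diff:
  "t \<in> carrier formal_tensors \<Longrightarrow> u \<in> carrier formal_tensors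
    \<Longrightarrow> t - u \<in> carrier (formal_tensors :: 'a formal_tensor monoid)"
  unfolding formal_tensors_def using keys_diff[of t u] by auto

lemma formal_tensors_generator:
  "x \<in> carrier center_fraction_field \<Longrightarrow> frag_of (a, x) \<in> carrier (formal_tensors :: 'a formal_tensor monoid)"
  unfolding formal_tensors_def by simp

lemma formal_tensors_induct [consumes 1, case_names zero generator diff]:
  assumes "t \<in> carrier (formal_tensors :: 'a formal_tensor monoid)"
    and "P 0" "\<And>a x. x \<in> carrier center_fraction_field \<Longrightarrow> P (frag_of (a, x))"
    and "\<And>t u. P t \<Longrightarrow> P u \<Longrightarrow> P (t - u)"
  shows "P t"
proof -
  have "Poly_Mapping.keys t \<subseteq> UNIV \<times> carrier center_fraction_field"
    using assms(1) unfolding formal_tensors_def by simp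
  then show ?thesis
    by (induction t rule: frag_induction) (use assms in auto)
qed

lemma tensor_relations_carrier: "tensor_relations \<subseteq> carrier (formal_tensors :: 'a formal_tensor monoid)"
  unfolding tensor_relations_def
  using fraction_add_closed fraction_mult_closed center_fract_closed center_one
  by (auto intro!: formal_tensors_diff formal_tensors_generator)

lemma tensor_kernel_subgroup: "subgroup tensor_kernel (formal_tensors :: 'a formal_tensor monoid)"
  unfolding tensor_kernel_def
  by (intro group.generate_is_subgroup tensor_relations_carrier)
     (simp add: formal_tensors_def)

lemma tensor_kernel_carrier: "t \<in> tensor_kernel \<Longrightarrow> t \<in> carrier (formal_tensors :: 'a formal_tensor monoid)"
  using tensor_kernel_subgroup subgroup.subset by blast

lemma formal_tensors_inv:
  "t \<in> carrier (formal_tensors :: 'a formal_tensor monoid) \<Longrightarrow> inv\<^bsub>formal_tensors\<^esub> t = - t"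
  unfolding formal_tensors_def by simp

lemma formal_tensors_mult: "t \<otimes>\<^bsub>formal_tensors\<^esub> u = t + (u :: 'a formal_tensor)"
  unfolding formal_tensors_def by simp

lemma tensor_kernel_zero: "0 \<in> (tensor_kernel :: 'a formal_tensor set)"
  using subgroup.one_closed[OF tensor_kernel_subgroup] by (simp add: formal_tensors_def)

lemma tensor_kernel_add:
  "t \<in> tensor_kernel \<Longrightarrow> u \<in> tensor_kernel \<Longrightarrow> t + u \<in> (tensor_kernel :: 'a formal_tensor set)"
  using subgroup.m_closed[OF tensor_kernel_subgroup] by (simp add: formal_tensors_mult)

lemma tensor_kernel_minus:
  "t \<in> tensor_kernel \<Longrightarrow> - t \<in> (tensor_kernel :: 'a formal_tensor set)"
  using subgroup.m_inv_closed[OF tensor_kernel_subgroup] tensor_kernel_carrier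
  by (simp add: formal_tensors_inv)

lemma tensor_kernel_diff:
  "t \<in> tensor_kernel \<Longrightarrow> u \<in> tensor_kernel \<Longrightarrow> t - u \<in> (tensor_kernel :: 'a formal_tensor set)"
  using tensor_kernel_add[OF _ tensor_kernel_minus] by force

lemma tensor_kernel_relation: "t \<in> tensor_relations \<Longrightarrow> t \<in> (tensor_kernel :: 'a formal_tensor set)"
  unfolding tensor_kernel_def by (rule generate.incl)

lemma tensor_kernel_induct [consumes 1, case_names zero relation diff]:
  assumes "t \<in> (tensor_kernel :: 'a formal_tensor set)"
    and zero: "P 0" and rel: "\<And>t. t \<in> tensor_relations \<Longrightarrow> P t"
    and diff: "\<And>t u. P t \<Longrightarrow> P u \<Longrightarrow> P (t - u)"
  shows "P t"
proof -
  have minus: "P (- t)" if "P t" for t using diff[OF zero that] by simp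
  have add: "P (t + u)" if "P t" "P u" for t u using diff[OF that(1) minus[OF that(2)]] by simp
  show ?thesis
    using assms(1) unfolding tensor_kernel_def
  proof (induction rule: generate.induct)
    case one
    then show ?case using zero by (simp add: formal_tensors_def)
  next
    case (incl h)
    then show ?case by (rule rel)
  next
    case (inv h)
    then show ?case using minus rel tensor_relations_carrier formal_tensors_inv by (metis subsetD)
  next
    case (eng h k)
    then show ?case using add by (simp add: formal_tensors_mult)
  qed
qed

lemma tensor_relations_cases [consumes 1, case_names add_left add_right balanced]:
  assumes "t \<in> (tensor_relations :: 'a formal_tensor set)"
  obtains a b x where "x \<in> carrier center_fraction_field"
      "t = frag_of (a + b, x) - frag_of (a, x) - frag_of (b, x)"
    | a x y where "x \<in> carrier center_fraction_field" "y \<in> carrier center_fraction_field"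
      "t = frag_of (a, x \<oplus>\<^bsub>center_fraction_field\<^esub> y) - frag_of (a, x) - frag_of (a, y)"
    | a z x where "z \<in> center" "x \<in> carrier center_fraction_field"
      "t = frag_of (a * z, x) - frag_of (a, center_fract z 1 \<otimes>\<^bsub>center_fraction_field\<^esub> x)"
  using assms unfolding tensor_relations_def by blast

lemma relation_add_left:
  "x \<in> carrier center_fraction_field \<Longrightarrow>
    frag_of (a + b, x) - frag_of (a, x) - frag_of (b, x) \<in> (tensor_kernel :: 'a formal_tensor set)"
  by (rule tensor_kernel_relation) (auto simp: tensor_relations_def)

lemma relation_add_right:
  "x \<in> carrier center_fraction_field \<Longrightarrow> y \<in> carrier center_fraction_field \<Longrightarrow>
    frag_of (a, x \<oplus>\<^bsub>center_fraction_field\<^esub> y) - frag_of (a, x) - frag_of (a, y)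
      \<in> (tensor_kernel :: 'a formal_tensor set)"
  by (rule tensor_kernel_relation) (auto simp: tensor_relations_def)

lemma relation_balanced:
  "z \<in> center \<Longrightarrow> x \<in> carrier center_fraction_field \<Longrightarrow>
    frag_of (a * z, x) - frag_of (a, center_fract z 1 \<otimes>\<^bsub>center_fraction_field\<^esub> x)
      \<in> (tensor_kernel :: 'a formal_tensor set)"
  by (rule tensor_kernel_relation) (auto simp: tensor_relations_def)

lemma formal_mult_generators:
  "formal_mult (frag_of (a, x)) (frag_of (b, y))
    = (frag_of (a * b, x \<otimes>\<^bsub>center_fraction_field\<^esub> y) :: 'a formal_tensor)"
  by (simp add: formal_mult_def)

lemma formal_mult_diff_left:
  "formal_mult (t - t') u = formal_mult t u - (formal_mult t' u :: 'a formal_tensor)"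
  by (simp add: formal_mult_def frag_extend_diff)

lemma formal_mult_diff_right:
  "formal_mult t (u - u') = formal_mult t u - (formal_mult t u' :: 'a formal_tensor)"
proof (induction t rule: frag_induction[OF subset_UNIV])
  case 1
  then show ?case by (simp add: formal_mult_def)
next
  case (2 x)
  then show ?case by (cases x) (simp add: formal_mult_def frag_extend_diff)
next
  case (3 t t')
  then show ?case by (simp add: formal_mult_diff_left)
qed

lemma formal_mult_zero: "formal_mult 0 u = (0 :: 'a formal_tensor)" "formal_mult t 0 = (0 :: 'a formal_tensor)"
  using formal_mult_diff_left[of 0 0 u] formal_mult_diff_right[of t 0 0] by simp_all

text \<open>
  The tensor relations form a two-sided ideal for the formal multiplication: a generator times a relation is
  again a relation of the same kind.
\<close>

lemma formal_mult_kernel_right: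
  assumes "x \<in> carrier center_fraction_field" "u \<in> (tensor_kernel :: 'a formal_tensor set)"
  shows "formal_mult (frag_of (a, x)) u \<in> tensor_kernel"
  using assms(2)
proof (induction rule: tensor_kernel_induct)
  case zero
  then show ?case by (simp add: formal_mult_zero tensor_kernel_zero)
next
  case (diff t u)
  then show ?case by (simp add: formal_mult_diff_right tensor_kernel_diff)
next
  case (relation t)
  then show ?case
  proof (cases rule: tensor_relations_cases)
    case (add_left b c y)
    then show ?thesis using assms(1)
      by (simp add: formal_mult_diff_right formal_mult_generators distrib_left
          relation_add_left fraction_mult_closed)
  next
    case (add_right b y y')
    then show ?thesis using assms(1)
      by (simp add: formal_mult_diff_right formal_mult_generators fraction_distrib_left
          relation_add_right fraction_mult_closed)
  next
    case (balanced b z y)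
    have z: "center_fract z 1 \<in> carrier center_fraction_field"
      using balanced(1) center_one by (intro center_fract_closed) auto
    have "x \<otimes>\<^bsub>center_fraction_field\<^esub> (center_fract z 1 \<otimes>\<^bsub>center_fraction_field\<^esub> y)
        = center_fract z 1 \<otimes>\<^bsub>center_fraction_field\<^esub> (x \<otimes>\<^bsub>center_fraction_field\<^esub> y)"
      using fraction_mult_assoc[OF z assms(1) balanced(2)] fraction_mult_assoc[OF assms(1) z balanced(2)]
        fraction_mult_commute[OF z assms(1)] by simp
    then show ?thesis using balanced assms(1)
        relation_balanced[of z "x \<otimes>\<^bsub>center_fraction_field\<^esub> y" "a * b"]
      by (simp add: formal_mult_diff_right formal_mult_generators fraction_mult_closed mult.assoc)
  qed
qed

lemma formal_mult_kernel_left: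
  assumes "u \<in> carrier formal_tensors" "t \<in> (tensor_kernel :: 'a formal_tensor set)"
  shows "formal_mult t u \<in> tensor_kernel"
  using assms
proof (induction arbitrary: t rule: formal_tensors_induct)
  case zero
  then show ?case by (simp add: formal_mult_zero tensor_kernel_zero)
next
  case (diff u u')
  then show ?case by (simp add: formal_mult_diff_right tensor_kernel_diff)
next
  case (generator b y)
  from generator(2) show ?case
  proof (induction rule: tensor_kernel_induct)
    case zero
    then show ?case by (simp add: formal_mult_zero tensor_kernel_zero)
  next
    case (diff t u)
    then show ?case by (simp add: formal_mult_diff_left tensor_kernel_diff)
  next
    case (relation t)
    then show ?case
    proof (cases rule: tensor_relations_cases)
      case (add_left a c x)
      then show ?thesis using generator(1)
        by (simp add: formal_mult_diff_left formal_mult_generators distrib_right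
            relation_add_left fraction_mult_closed)
    next
      case (add_right a x x')
      then show ?thesis using generator(1)
        by (simp add: formal_mult_diff_left formal_mult_generators fraction_distrib
            relation_add_right fraction_mult_closed)
    next
      case (balanced a z x)
      have z: "center_fract z 1 \<in> carrier center_fraction_field"
        using balanced(1) center_one by (intro center_fract_closed) auto
      have "a * z * b = a * b * z"
        using center_commute[OF balanced(1), of b] by (simp add: mult.assoc)
      then show ?thesis using balanced generator(1)
          relation_balanced[of z "x \<otimes>\<^bsub>center_fraction_field\<^esub> y" "a * b"]
        by (simp add: formal_mult_diff_left formal_mult_generators fraction_mult_closed
            fraction_mult_assoc[OF z])
    qed
  qed
qed

lemma mem_tensor_class_iff: "u \<in> tensor_class t \<longleftrightarrow> u - t \<in> (tensor_kernel :: 'a formal_tensor set)"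
proof -
  have "u \<in> tensor_class t \<longleftrightarrow> (\<exists>k\<in>tensor_kernel. u = k + t)"
    by (auto simp: tensor_class_def r_coset_def formal_tensors_mult)
  also have "\<dots> \<longleftrightarrow> u - t \<in> tensor_kernel" by (auto intro!: bexI[of _ "u - t"])
  finally show ?thesis .
qed

lemma tensor_class_eq_iff: "tensor_class t = tensor_class u \<longleftrightarrow> t - u \<in> (tensor_kernel :: 'a formal_tensor set)"
proof
  assume "tensor_class t = tensor_class u"
  moreover have "t \<in> tensor_class t" by (simp add: mem_tensor_class_iff tensor_kernel_zero)
  ultimately show "t - u \<in> tensor_kernel" by (simp add: mem_tensor_class_iff)
next
  assume tu: "t - u \<in> tensor_kernel"
  have "v - t \<in> tensor_kernel \<longleftrightarrow> v - u \<in> tensor_kernel" for v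
    using tensor_kernel_add[OF _ tu, of "v - t"] tensor_kernel_diff[OF _ tu, of "v - u"] by auto
  then show "tensor_class t = tensor_class u" by (auto simp: mem_tensor_class_iff)
qed

lemma pure_tensor_mult:
  assumes "x \<in> carrier center_fraction_field" "y \<in> carrier center_fraction_field"
  shows "pure_tensor a x \<otimes>\<^bsub>central_quotient_ring\<^esub> pure_tensor b y
    = pure_tensor (a * b) (x \<otimes>\<^bsub>center_fraction_field\<^esub> y :: ('a \<times> 'a) set)"
proof -
  let ?f = "frag_of (a, x)" and ?g = "frag_of (b, y)"
  have rep: "tensor_class (formal_mult t u) = tensor_class (formal_mult ?f ?g)"
    if "t \<in> tensor_class ?f" "u \<in> tensor_class ?g" for t u
  proof -
    have t: "t - ?f \<in> tensor_kernel" and u: "u - ?g \<in> tensor_kernel"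
      using that by (simp_all add: mem_tensor_class_iff)
    have "?g - (0 - (u - ?g)) \<in> carrier formal_tensors"
      by (rule formal_tensors_diff[OF formal_tensors_generator[OF assms(2)] formal_tensors_diff[OF
          tensor_kernel_carrier[OF tensor_kernel_zero] tensor_kernel_carrier[OF u]]])
    then have "u \<in> carrier formal_tensors" by simp
    then have "formal_mult (t - ?f) u + formal_mult ?f (u - ?g) \<in> tensor_kernel"
      using t u assms formal_mult_kernel_left formal_mult_kernel_right tensor_kernel_add by blast
    then show ?thesis
      by (simp add: tensor_class_eq_iff formal_mult_diff_left formal_mult_diff_right)
  qed
  have "?f \<in> tensor_class ?f" "?g \<in> tensor_class ?g"
    by (simp_all add: mem_tensor_class_iff tensor_kernel_zero)
  with rep have "(\<Union>t\<in>tensor_class ?f. \<Union>u\<in>tensor_class ?g. tensor_class (formal_mult t u))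
      = tensor_class (formal_mult ?f ?g)"
    by fast
  then show ?thesis
    by (simp add: central_quotient_ring_def pure_tensor_def formal_mult_generators)
qed

lemma pure_tensor_add:
  assumes "x \<in> carrier center_fraction_field"
  shows "pure_tensor a x \<oplus>\<^bsub>central_quotient_ring\<^esub> pure_tensor b x
    = pure_tensor (a + b) (x :: ('a \<times> 'a) set)"
proof -
  have "pure_tensor a x \<oplus>\<^bsub>central_quotient_ring\<^esub> pure_tensor b x
    = tensor_class (frag_of (a, x)) <#>\<^bsub>formal_tensors\<^esub> tensor_class (frag_of (b, x))"
    by (simp add: central_quotient_ring_def FactGroup_def pure_tensor_def)
  also have "\<dots> = tensor_class (frag_of (a, x) + frag_of (b, x))" (is "?l = tensor_class (?f + ?g)")
  proof
    show "?l \<subseteq> tensor_class (?f + ?g)"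
    proof
      fix v assume "v \<in> ?l"
      then obtain t u where "v = t + u" "t - ?f \<in> tensor_kernel" "u - ?g \<in> tensor_kernel"
        by (auto simp: set_mult_def formal_tensors_mult mem_tensor_class_iff)
      then show "v \<in> tensor_class (?f + ?g)"
        using tensor_kernel_add[of "t - ?f" "u - ?g"] by (simp add: mem_tensor_class_iff algebra_simps)
    qed
    show "tensor_class (?f + ?g) \<subseteq> ?l"
    proof
      fix v assume "v \<in> tensor_class (?f + ?g)"
      then have "v - ?g \<in> tensor_class ?f" "?g \<in> tensor_class ?g"
        by (simp_all add: mem_tensor_class_iff tensor_kernel_zero algebra_simps)
      then have "(v - ?g) \<otimes>\<^bsub>formal_tensors\<^esub> ?g \<in> ?l" unfolding set_mult_def by blast
      then show "v \<in> ?l" by (simp add: formal_tensors_mult)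
    qed
  qed
  also have "\<dots> = pure_tensor (a + b) x"
    using tensor_kernel_minus[OF relation_add_left[OF assms, of a b]]
    by (simp add: pure_tensor_def tensor_class_eq_iff algebra_simps)
  finally show ?thesis .
qed

lemma pure_tensor_balanced:
  assumes "z \<in> center" "x \<in> carrier center_fraction_field"
  shows "pure_tensor (a * z) x = pure_tensor a (center_fract z 1 \<otimes>\<^bsub>center_fraction_field\<^esub> x :: ('a \<times> 'a) set)"
  using relation_balanced[OF assms] by (simp add: pure_tensor_def tensor_class_eq_iff)


text \<open>
  The map \<open>a \<otimes> x \<mapsto> a x\<close> into fractions over \<open>A\<close>, without constructing these: for fractions \<open>x\<close> that have the
  denominator \<open>w\<close>, the values \<open>a x w\<close> lie in \<open>A\<close>.  The arbitrary choice made for other \<open>x\<close> is harmless because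
  \<open>w\<close> is only ever taken divisible enough.
\<close>

definition numerator_over :: "'a \<Rightarrow> ('a \<times> 'a) set \<Rightarrow> 'a" where
  "numerator_over w x = (SOME c. c \<in> center \<and> x = center_fract c w)"

definition value_over :: "'a \<Rightarrow> 'a formal_tensor \<Rightarrow> 'a" where
  "value_over w t =
     (\<Sum>k\<in>Poly_Mapping.keys t. of_int (Poly_Mapping.lookup t k) * (fst k * numerator_over w (snd k)))"

lemma numerator_over_multiple:
  assumes "c \<in> center" "z \<in> center - {0}" "v \<in> center - {0}"
  shows "numerator_over (z * v) (center_fract c z) = c * v"
  unfolding numerator_over_def
proof (rule some_equality)
  show "c * v \<in> center \<and> center_fract c z = center_fract (c * v) (z * v)"
    using assms center_nonzero_mult[OF assms(2,3)]
    by (simp add: center_fract_eq_iff center_mult center_ac)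
next
  fix d assume d: "d \<in> center \<and> center_fract c z = center_fract d (z * v)"
  then have "c * (z * v) = d * z"
    using assms center_nonzero_mult[OF assms(2,3)] by (blast dest: center_fract_eq_iff[THEN iffD1, rotated 4])
  then have "d * z = (c * v) * z" using assms by (simp add: center_ac)
  then show "d = c * v" using assms right_cancel by blast
qed

lemma value_over_superset:
  assumes "finite K" "Poly_Mapping.keys t \<subseteq> K"
  shows "value_over w t
    = (\<Sum>k\<in>K. of_int (Poly_Mapping.lookup t k) * (fst k * numerator_over w (snd k)))"
  unfolding value_over_def using assms
  by (intro sum.mono_neutral_left) (auto simp: in_keys_iff)

lemma value_over_diff: "value_over w (t - u) = value_over w t - value_over w u"
proof -
  let ?K = "Poly_Mapping.keys t \<union> Poly_Mapping.keys u"
  show ?thesis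
    using keys_diff[of t u]
    by (simp add: value_over_superset[of ?K] lookup_minus left_diff_distrib sum_subtractf)
qed

lemma value_over_generator: "value_over w (frag_of (a, x)) = a * numerator_over w x"
  by (simp add: value_over_def)

text \<open>
  Each relation involves finitely many denominators, and its value vanishes over every common multiple of them.
  Quantifying over all further multiples \<open>w\<close> lets two relations share a denominator in the induction.
\<close>

lemma value_over_kernel:
  assumes "t \<in> tensor_kernel"
  shows "\<exists>v\<in>center - {0}. \<forall>w\<in>center - {0}. value_over (v * w) t = 0"
  using assms
proof (induction rule: tensor_kernel_induct)
  case zero
  then show ?case using center_one by (intro bexI[of _ 1]) (auto simp: value_over_def)
next
  case (diff t u)
  then obtain v v' where v: "v \<in> center - {0}" "\<And>w. w \<in> center - {0} \<Longrightarrow> value_over (v * w) t = 0"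
    and v': "v' \<in> center - {0}" "\<And>w. w \<in> center - {0} \<Longrightarrow> value_over (v' * w) u = 0"
    by blast
  have "value_over (v * v' * w) (t - u) = 0" if w: "w \<in> center - {0}" for w
  proof -
    have eqs: "v * v' * w = v * (v' * w)" "v * v' * w = v' * (v * w)"
      using v(1) center_left_commute[of v v' w] by (simp_all add: mult.assoc)
    have "value_over (v * v' * w) t = 0" "value_over (v * v' * w) u = 0"
      using v(2)[OF center_nonzero_mult[OF v'(1) w]] v'(2)[OF center_nonzero_mult[OF v(1) w]]
      by (simp_all only: flip: eqs)
    then show ?thesis by (simp add: value_over_diff)
  qed
  then show ?case using center_nonzero_mult[OF v(1) v'(1)] by blast
next
  case (relation t)
  then show ?case
  proof (cases rule: tensor_relations_cases)
    case (add_left a b x)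
    then show ?thesis using center_one
      by (intro bexI[of _ 1]) (auto simp: value_over_diff value_over_generator distrib_right)
  next
    case (add_right a x y)
    obtain c z where x: "c \<in> center" "z \<in> center - {0}" "x = center_fract c z"
      using add_right(1) by (rule center_fract_cases)
    obtain d z' where y: "d \<in> center" "z' \<in> center - {0}" "y = center_fract d z'"
      using add_right(2) by (rule center_fract_cases)
    have "value_over (z * z' * w) t = 0" if w: "w \<in> center - {0}" for w
    proof -
      have "numerator_over (z * z' * w) x = c * (z' * w)"
        unfolding x(3) mult.assoc using x y w by (intro numerator_over_multiple center_nonzero_mult)
      moreover have "numerator_over (z' * (z * w)) y = d * (z * w)"
        unfolding y(3) using x y w by (intro numerator_over_multiple center_nonzero_mult)
      moreover have "z' * (z * w) = z * z' * w"
        using x center_left_commute[of z z' w] by (simp add: mult.assoc)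
      moreover have "numerator_over (z * z' * w) (center_fract (c * z' + d * z) (z * z')) = (c * z' + d * z) * w"
        using x y w by (intro numerator_over_multiple center_nonzero_mult center_add center_mult) auto
      moreover have "x \<oplus>\<^bsub>center_fraction_field\<^esub> y = center_fract (c * z' + d * z) (z * z')"
        unfolding x(3) y(3) using x y by (intro center_fract_add) auto
      ultimately show ?thesis
        by (simp add: add_right(3) value_over_diff value_over_generator distrib_left distrib_right mult.assoc)
    qed
    then show ?thesis using center_nonzero_mult[OF x(2) y(2)] by blast
  next
    case (balanced a z x)
    obtain c v where x: "c \<in> center" "v \<in> center - {0}" "x = center_fract c v"
      using balanced(2) by (rule center_fract_cases)
    have "value_over (v * w) t = 0" if w: "w \<in> center - {0}" for w
    proof -
      have "center_fract z 1 \<otimes>\<^bsub>center_fraction_field\<^esub> x = center_fract (z * c) v"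
        using balanced(1) x center_one by (simp add: center_fract_mult)
      moreover have "numerator_over (v * w) (center_fract (z * c) v) = z * c * w"
        "numerator_over (v * w) x = c * w"
        unfolding x(3) using balanced(1) x w by (auto intro!: numerator_over_multiple center_mult)
      ultimately show ?thesis
        by (simp add: balanced(3) value_over_diff value_over_generator mult.assoc)
    qed
    then show ?thesis using x(2) by blast
  qed
qed

text \<open>
  Multiplying by a sufficiently divisible denominator recovers \<open>a v\<close> from \<open>a \<otimes> 1/w\<close>, and \<open>v\<close> cancels in a domain.
\<close>

lemma pure_tensor_inject:
  assumes "w \<in> center - {0 :: 'a}" "pure_tensor a (center_fract 1 w) = pure_tensor b (center_fract 1 w)"
  shows "a = b"
proof -
  have "frag_of (a, center_fract 1 w) - frag_of (b, center_fract 1 w) \<in> tensor_kernel"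
    using assms(2) by (simp add: pure_tensor_def tensor_class_eq_iff)
  then obtain v where v: "v \<in> center - {0}"
    and "value_over (v * w) (frag_of (a, center_fract 1 w) - frag_of (b, center_fract 1 w)) = 0"
    using value_over_kernel assms(1) by blast
  moreover have "numerator_over (v * w) (center_fract 1 w) = v"
    using numerator_over_multiple[OF center_one assms(1) v] v center_commute[of v w] by simp
  ultimately have "a * v = b * v"
    by (simp add: value_over_diff value_over_generator)
  then show ?thesis using v right_cancel by blast
qed

lemma one_over_closed: "z \<in> center - {0::'a} \<Longrightarrow> center_fract 1 z \<in> carrier center_fraction_field"
  using center_one by (rule center_fract_closed)

lemma one_nonzero_center: "1 \<in> (center - {0} :: 'a set)"
  using center_one by simp

lemma quotient_embed_over:
  assumes "z \<in> center - {0::'a}"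
  shows "quotient_embed x = pure_tensor (x * z) (center_fract 1 z)"
proof -
  have "center_fract z 1 \<otimes>\<^bsub>center_fraction_field\<^esub> center_fract 1 z = center_fract 1 1"
    using assms center_one one_nonzero_center
    by (simp add: center_fract_mult center_fract_eq_iff)
  then show ?thesis
    using assms one_over_closed[OF assms] by (simp add: pure_tensor_balanced quotient_embed_def)
qed

lemma inverse_multiples_eq:
  assumes "z \<in> center - {0::'a}"
  shows "inverse_multiples z = range (\<lambda>a. pure_tensor a (center_fract 1 z))"
proof -
  have "pure_tensor 1 (center_fract 1 z) \<otimes>\<^bsub>central_quotient_ring\<^esub> quotient_embed a
      = pure_tensor a (center_fract 1 z)" for a
    unfolding quotient_embed_def
    using assms one_over_closed[OF assms] one_over_closed[OF one_nonzero_center] center_one one_nonzero_center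
    by (simp add: pure_tensor_mult center_fract_mult)
  then show ?thesis unfolding inverse_multiples_def by auto
qed

text \<open>
  For a ring \<open>B\<close> between \<open>A\<close> and \<open>z^-1 A\<close> take \<open>T = z B\<close>, a subset of \<open>A\<close>.  It is stable under adding multiples of \<open>z\<close>
  because \<open>A\<close> lies in \<open>B\<close>; and for \<open>a \<in> T\<close> the power \<open>(a / z)^n\<close> lies in \<open>B\<close>, hence is of the form \<open>c / z\<close>.  That
  \<open>B = A\<close> means that all of \<open>T\<close> is divisible by \<open>z\<close>.  So maximality becomes a statement about \<open>A\<close> alone.
\<close>

lemma maximal_orderI:
  assumes fg: "fin_gen_over_center TYPE('a)"
    and closed: "\<And>z T. z \<in> center - {0::'a} \<Longrightarrow> (\<And>a x. a \<in> T \<Longrightarrow> a + x * z \<in> T) \<Longrightarrow>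
       (\<And>a n. a \<in> T \<Longrightarrow> \<exists>c. a ^ n * z = z ^ n * c) \<Longrightarrow> T \<subseteq> range (\<lambda>x. x * z)"
  shows "maximal_order TYPE('a)"
  unfolding maximal_order_def
proof (intro conjI allI impI dom fg)
  fix B :: "'a formal_tensor set set"
  assume B: "subring B central_quotient_ring" and embed: "range quotient_embed \<subseteq> B"
    and "\<exists>z\<in>center - {0::'a}. B \<subseteq> inverse_multiples z"
  then obtain z where z: "z \<in> center - {0}" and Bz: "B \<subseteq> inverse_multiples z" by blast
  let ?p = "\<lambda>a. pure_tensor a (center_fract 1 z)"
  note over = one_over_closed[OF z]
  define T where "T = {a. ?p a \<in> B}"
  have mult_B: "X \<otimes>\<^bsub>central_quotient_ring\<^esub> Y \<in> B" if "X \<in> B" "Y \<in> B" for X Y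
    using subring.axioms(2)[OF B] that by (rule submonoid.m_closed)
  have add_B: "X \<oplus>\<^bsub>central_quotient_ring\<^esub> Y \<in> B" if "X \<in> B" "Y \<in> B" for X Y
    using subgroup.m_closed[OF subring.axioms(1)[OF B]] that by simp
  have embed_T: "x * z \<in> T" for x
    using embed unfolding T_def quotient_embed_over[OF z] by blast
  have T_add: "a + x * z \<in> T" if "a \<in> T" for a x
    using add_B[of "?p a" "?p (x * z)"] that embed_T[of x] over unfolding T_def
    by (simp add: pure_tensor_add)
  have T_mult: "\<exists>e\<in>T. a * c = e * z" if "a \<in> T" "c \<in> T" for a c
  proof -
    \<comment> \<open>The product of two fractions over \<open>z\<close> lies over \<open>z * z\<close>; being in \<open>B\<close>, it also lies over \<open>z\<close>.\<close>
    have zz: "z * z \<in> center - {0}" using z by (intro center_nonzero_mult)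
    have "?p a \<otimes>\<^bsub>central_quotient_ring\<^esub> ?p c = pure_tensor (a * c) (center_fract 1 (z * z))"
      using over z center_one by (simp add: pure_tensor_mult center_fract_mult)
    moreover have "?p a \<otimes>\<^bsub>central_quotient_ring\<^esub> ?p c \<in> B"
      using that mult_B unfolding T_def by blast
    ultimately obtain e where e: "pure_tensor (a * c) (center_fract 1 (z * z)) = ?p e" "e \<in> T"
      using Bz unfolding inverse_multiples_eq[OF z] T_def by auto
    have "center_fract z 1 \<otimes>\<^bsub>center_fraction_field\<^esub> center_fract 1 (z * z) = center_fract 1 z"
      using z zz center_one one_nonzero_center
      by (simp add: center_fract_mult center_fract_eq_iff)
    then have "?p e = pure_tensor (e * z) (center_fract 1 (z * z))"
      using z one_over_closed[OF zz] by (simp add: pure_tensor_balanced)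
    with e show ?thesis using pure_tensor_inject[OF zz] by metis
  qed
  have "\<exists>c\<in>T. a ^ n * z = z ^ n * c" if a: "a \<in> T" for a n
  proof (induction n)
    case 0
    then show ?case using embed_T[of 1] by auto
  next
    case (Suc n)
    then obtain c where c: "c \<in> T" "a ^ n * z = z ^ n * c" by blast
    obtain e where e: "e \<in> T" "a * c = e * z" using T_mult[OF a c(1)] by blast
    have zn: "z ^ n \<in> center"
      using z center_one by (induction n) (auto intro: center_mult)
    have "a ^ Suc n * z = a * (z ^ n * c)" by (simp add: mult.assoc flip: c(2))
    also have "\<dots> = z ^ n * (a * c)" using zn by (rule center_left_commute)
    also have "\<dots> = z ^ Suc n * e"
      using z center_commute[of z e] unfolding e(2) by (simp add: mult.assoc power_Suc2 del: power_Suc)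
    finally show ?case using e(1) by blast
  qed
  then have "T \<subseteq> range (\<lambda>x. x * z)"
    using z T_add by (intro closed) blast+
  then have "B \<subseteq> range quotient_embed"
    using Bz unfolding inverse_multiples_eq[OF z] T_def quotient_embed_over[OF z] by blast
  with embed show "B = range quotient_embed" by blast
qed

end

section \<open>Maximality\<close>

theorem proposition3p7p2:
  fixes r p :: nat
    and \<Lambda> :: "(nat \<Rightarrow> int) set"
    and scale :: "complex \<Rightarrow> 'a::ring_1 \<Rightarrow> 'a"
    and s :: "(nat \<Rightarrow> int) \<Rightarrow> 'a"
    and deg :: "(nat \<Rightarrow> int) \<Rightarrow> (nat \<Rightarrow> nat)"
    and q :: complex
    and C :: "(nat \<Rightarrow> int) \<Rightarrow> (nat \<Rightarrow> int) \<Rightarrow> int"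
  assumes "p > 0"
    and "\<Lambda> \<subseteq> tuples r"
    and "add_submonoid \<Lambda>"
    and "fin_gen_submonoid \<Lambda>"
    and "primitive_in_completion \<Lambda>"
    and "complex_algebra scale"
    and "fin_gen_over_center TYPE('a)"
    and "inj_on s \<Lambda>"
    and "\<not> module.dependent scale (s ` \<Lambda>)"
    and "module.span scale (s ` \<Lambda>) = UNIV"
    and "\<And>m. m \<in> \<Lambda> \<Longrightarrow> deg m \<in> tuples p"
    and "deg 0 = 0"
    and "\<And>m m'. m \<in> \<Lambda> \<Longrightarrow> m' \<in> \<Lambda> \<Longrightarrow> deg (m + m') = deg m + deg m'"
    and "\<exists>n>0. q ^ n = 1"
    and "\<And>m m'. m \<in> \<Lambda> \<Longrightarrow> m' \<in> \<Lambda> \<Longrightarrow>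
           s m * s m' - scale (q powi C m m') (s (m + m'))
             \<in> filtration_less scale \<Lambda> s deg (deg m + deg m')"
  shows "is_domain TYPE('a) \<and> maximal_order TYPE('a)"
proof -
  interpret alg: complex_algebra scale by fact
  have q: "q \<noteq> 0" using \<open>\<exists>n>0. q ^ n = 1\<close> by (auto simp: power_0_left)
  interpret monomial_filtration scale r p \<Lambda> s deg q C
    by unfold_locales (fact assms q)+
  have "maximal_order TYPE('a)"
    using no_zero_divisors \<open>fin_gen_over_center TYPE('a)\<close>
  proof (rule maximal_orderI)
    fix z :: 'a and T
    assume "z \<in> center - {0}" "\<And>a x. a \<in> T \<Longrightarrow> a + x * z \<in> T"
      "\<And>a n. a \<in> T \<Longrightarrow> \<exists>c. a ^ n * z = z ^ n * c"
    then show "T \<subseteq> range (\<lambda>x. x * z)" by (intro division_terminates) auto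
  qed
  with no_zero_divisors show ?thesis by blast
qed

end
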